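(* Let $L:A\to\mathbb R$ be a linear positive semidefinite functional with $L(1)=1$. Then there exists a unique representing Radon measure $\mu_L$ for $L$ with compact support if and only if $$\sup_{x\in A,\,L(x^2)\ne 0}\frac{L(ax^2)}{L(x^2)}<\infty\quad\text{and}\quad \inf_{x\in A,\,L(x^2)\ne 0}\frac{L(ax^2)}{L(x^2)}>-\infty\quad\text{for all }a\in A.$$ Moreover, in this case, the support of $\mu_L$ is a subset of the set $K$ of all $\alpha\in X(A)$ such that $$\inf_{x\in A,\,L(x^2)\ne 0}\frac{L(ax^2)}{L(x^2)}\le\alpha(a)\le\sup_{x\in A,\,L(x^2)\ne 0}\frac{L(ax^2)}{L(x^2)}\quad\text{for all }a\in A,$$ and for all $a\in A$ $$\sup_{\alpha\in K}\alpha(a)=\sup_{x\in A,\,L(x^2)\ne 0}\frac{L(ax^2)}{L(x^2)},\qquad \inf_{\alpha\in K}\alpha(a)=\inf_{x\in A,\,L(x^2)\ne 0}\frac{L(ax^2)}{L(x^2)}.$$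
   Context: $A$ is a unital commutative $\mathbb R$-algebra and $X(A)$ is the set of all (unital) $\mathbb R$-algebra homomorphisms $A\to\mathbb R$, assumed non-empty and endowed with the topology of pointwise convergence. A linear functional $L:A\to\mathbb R$ is positive semidefinite if $L(a^2)\ge 0$ for all $a\in A$. A representing measure for $L$ is a positive Radon measure $\mu$ on $X(A)$ such that $L(a)=\int\alpha(a)\,d\mu(\alpha)$ for all $a\in A$. *)

theory Defs
  imports "HOL-Analysis.Analysis"
begin

definition characters :: "('a::{comm_ring_1, real_algebra_1} \<Rightarrow> real) set" where
  "characters = {\<alpha>. linear \<alpha> \<and> \<alpha> 1 = 1 \<and> (\<forall>a b. \<alpha> (a * b) = \<alpha> a * \<alpha> b)}"

text \<open>
  The topology on the type \<open>'a \<Rightarrow> real\<close> is the product topology, so its trace on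
  \<^const>\<open>characters\<close> is the topology of pointwise convergence.
\<close>

abbreviation character_space :: "('a::{comm_ring_1, real_algebra_1} \<Rightarrow> real) topology" where
  "character_space \<equiv> top_of_set characters"

text \<open>
  A Radon measure on a (Hausdorff) space: a Borel measure that is locally finite and inner
  regular with respect to compact sets. The first conjunct also determines the space of \<open>M\<close>,
  which is \<open>topspace T\<close>.
\<close>

definition radon_measure_on :: "'b topology \<Rightarrow> 'b measure \<Rightarrow> bool" where
  "radon_measure_on T M \<longleftrightarrow>
     sets M = sigma_sets (topspace T) {U. openin T U} \<and>
     (\<forall>x\<in>topspace T. \<exists>U. openin T U \<and> x \<in> U \<and> emeasure M U < \<infinity>) \<and>
     (\<forall>B\<in>sets M. emeasure M B = (SUP C\<in>{C. C \<subseteq> B \<and> compactin T C}. emeasure M C))"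

definition measure_support :: "'b topology \<Rightarrow> 'b measure \<Rightarrow> 'b set" where
  "measure_support T M = {x\<in>topspace T. \<forall>U. openin T U \<and> x \<in> U \<longrightarrow> emeasure M U > 0}"

text \<open>
  Integrability is required explicitly, since the Bochner integral of a non-integrable
  function is 0 by convention.
\<close>

definition representing_measure ::
    "('a::{comm_ring_1, real_algebra_1} \<Rightarrow> real) \<Rightarrow> ('a \<Rightarrow> real) measure \<Rightarrow> bool" where
  "representing_measure L M \<longleftrightarrow>
     radon_measure_on character_space M \<and>
     (\<forall>a. integrable M (\<lambda>\<alpha>. \<alpha> a) \<and> L a = (\<integral>\<alpha>. \<alpha> a \<partial>M))"

definition psd_functional :: "('a::{comm_ring_1, real_algebra_1} \<Rightarrow> real) \<Rightarrow> bool" where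
  "psd_functional L \<longleftrightarrow> (\<forall>a. L (a^2) \<ge> 0)"

text \<open>
  Suprema and infima are taken in the extended reals, so that no junk values arise for
  unbounded or empty families.
\<close>

definition quotient_sup :: "('a::{comm_ring_1, real_algebra_1} \<Rightarrow> real) \<Rightarrow> 'a \<Rightarrow> ereal" where
  "quotient_sup L a = (SUP x\<in>{x. L (x^2) \<noteq> 0}. ereal (L (a * x^2) / L (x^2)))"

definition quotient_inf :: "('a::{comm_ring_1, real_algebra_1} \<Rightarrow> real) \<Rightarrow> 'a \<Rightarrow> ereal" where
  "quotient_inf L a = (INF x\<in>{x. L (x^2) \<noteq> 0}. ereal (L (a * x^2) / L (x^2)))"

definition quotient_bounded_characters ::
    "('a::{comm_ring_1, real_algebra_1} \<Rightarrow> real) \<Rightarrow> ('a \<Rightarrow> real) set" where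
  "quotient_bounded_characters L =
     {\<alpha>\<in>characters. \<forall>a. quotient_inf L a \<le> ereal (\<alpha> a) \<and> ereal (\<alpha> a) \<le> quotient_sup L a}"

end

theory Submission
  imports Defs
begin

text \<open>
  Write \<open>M\<close> for the localizing module of \<open>L\<close>, the set of all \<open>a\<close> with \<open>L (a * x^2) \<ge> 0\<close> for every \<open>x\<close>.
  By Cauchy-Schwarz, \<open>L (x^2) = 0\<close> forces \<open>L (a * x^2) = 0\<close>, so a real \<open>c\<close> is a lower bound of the
  quotients of \<open>a\<close> exactly if \<open>a - c\<close> lies in \<open>M\<close>. Hence the set \<open>K\<close> of characters that respect all
  the bounds is the set of characters that are nonnegative on \<open>M\<close>, and finiteness of the bounds says
  that the quadratic module \<open>M\<close> is archimedean, which makes \<open>K\<close> compact.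

  The heart of the matter is that the infimum \<open>c\<close> of the quotients of \<open>a\<close> is attained at a character
  in \<open>K\<close> (\<open>quotient_inf_attained\<close>). Put \<open>d = a - c\<close>, an element of \<open>M\<close>, and adjoin the whole ideal
  generated by \<open>d\<close> to \<open>M\<close>. If the resulting quadratic module contained \<open>-1 = s + d * t\<close>, then
  Cauchy-Schwarz for the form \<open>L (d * u * v)\<close> would show that \<open>d - \<epsilon>\<close> is in \<open>M\<close> for some
  \<open>\<epsilon> > 0\<close>, against the choice of \<open>c\<close>. So the module is proper, and the representation theorem for
  archimedean quadratic modules (\<open>archimedean_quadratic_module_character\<close>) provides a character that
  is nonnegative on \<open>M\<close> and vanishes at \<open>d\<close>. This yields the formulas for infimum and supremum over
  \<open>K\<close>, and also that \<open>L a \<ge> 0\<close> whenever \<open>a\<close> is nonnegative on \<open>K\<close>.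

  By that positivity and the Stone-Weierstrass theorem \<open>L\<close> extends to a positive functional on the
  continuous functions on \<open>K\<close>, and the Riesz representation theorem turns it into a Radon measure
  carried by \<open>K\<close>. The Riesz measure comes from the outer measure whose value at an open set \<open>U\<close> is
  the supremum of the functional over continuous functions between \<open>0\<close> and the indicator of \<open>U\<close>.

  Conversely, a Radon measure is null outside its support. If the support is compact, every \<open>a\<close> takes
  values in some \<open>[-r, r]\<close> there, so \<open>r - a\<close> and \<open>a + r\<close> lie in \<open>M\<close> and the quotients are bounded
  by \<open>r\<close>. Two representing measures with compact support agree on all continuous functions on the
  union of their supports, again by Stone-Weierstrass, hence on compact sets by Urysohn's lemma and
  then everywhere by inner regularity. Uniqueness also places the support of any such measure in \<open>K\<close>,
  because the constructed measure has this property.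
\<close>

section \<open>Quadratic modules and characters\<close>

lemma charactersD:
  assumes "\<alpha> \<in> characters"
  shows "linear \<alpha>" "\<alpha> 1 = 1" "\<alpha> (a * b) = \<alpha> a * \<alpha> b"
proof -
  have "linear \<alpha> \<and> \<alpha> 1 = 1 \<and> (\<forall>a b. \<alpha> (a * b) = \<alpha> a * \<alpha> b)" using assms unfolding characters_def by blast
  then show "linear \<alpha>" "\<alpha> 1 = 1" "\<alpha> (a * b) = \<alpha> a * \<alpha> b" by blast+
qed

text \<open>
  Real scalars are not mentioned: a nonnegative scalar is the square of a scalar multiple of \<open>1\<close>, so
  quadratic modules are convex cones (\<open>quadratic_module_scaleR\<close>).
\<close>

definition quadratic_module :: "'a::{comm_ring_1, real_algebra_1} set \<Rightarrow> bool" where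
  "quadratic_module Q \<longleftrightarrow> 1 \<in> Q \<and> (\<forall>a\<in>Q. \<forall>b\<in>Q. a + b \<in> Q) \<and> (\<forall>x. \<forall>a\<in>Q. x^2 * a \<in> Q)"

lemma quadratic_moduleD:
  assumes "quadratic_module Q"
  shows "1 \<in> Q" "a \<in> Q \<Longrightarrow> b \<in> Q \<Longrightarrow> a + b \<in> Q" "a \<in> Q \<Longrightarrow> x^2 * a \<in> Q" "x^2 \<in> Q"
proof -
  show *: "1 \<in> Q" "a \<in> Q \<Longrightarrow> b \<in> Q \<Longrightarrow> a + b \<in> Q" "a \<in> Q \<Longrightarrow> x^2 * a \<in> Q" for x a b
    using assms by (auto simp: quadratic_module_def)
  show "x^2 \<in> Q" using *(3)[of 1 x] *(1) by simp
qed

lemma quadratic_module_scaleR: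
  assumes Q: "quadratic_module Q" and "a \<in> Q" "0 \<le> r"
  shows "r *\<^sub>R a \<in> Q"
proof -
  have "(sqrt r *\<^sub>R 1)^2 * a = r *\<^sub>R a"
    using \<open>0 \<le> r\<close> by (simp add: power2_eq_square)
  with quadratic_moduleD(3)[OF Q \<open>a \<in> Q\<close>, of "sqrt r *\<^sub>R 1"] show ?thesis by simp
qed

text \<open>
  The set of \<open>a\<close> with both \<open>a\<close> and \<open>-a\<close> in \<open>Q\<close> is an ideal, since every ring element \<open>c\<close> is the
  difference of squares \<open>(k + 1)^2 - k^2\<close> with \<open>k = (c - 1) / 2\<close>.
\<close>

lemma quadratic_module_support_ideal:
  assumes Q: "quadratic_module Q" and "a \<in> Q" "- a \<in> Q"
  shows "c * a \<in> Q"
proof -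
  define k where "k = (1/2) *\<^sub>R (c - 1)"
  have "(k + 1)^2 * a + k^2 * (- a) = (k + k + 1) * a"
    by (simp add: power2_eq_square algebra_simps)
  also have "k + k + 1 = c"
    by (simp add: k_def scaleR_left_distrib[symmetric])
  finally show ?thesis
    using quadratic_moduleD(2,3)[OF Q] assms(2,3) by metis
qed

lemma neg_one_in_quadratic_module:
  assumes Q: "quadratic_module Q" and "r *\<^sub>R 1 \<in> Q" "r < 0"
  shows "- 1 \<in> Q"
  using quadratic_module_scaleR[OF Q assms(2), of "- 1 / r"] assms(3) by simp

lemma maximal_proper_quadratic_module:
  assumes "quadratic_module Q0" "- 1 \<notin> Q0"
  obtains Q where "quadratic_module Q" "- 1 \<notin> Q" "Q0 \<subseteq> Q"
    "\<And>P. quadratic_module P \<Longrightarrow> - 1 \<notin> P \<Longrightarrow> Q \<subseteq> P \<Longrightarrow> P = Q"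
proof -
  let ?F = "{Q. quadratic_module Q \<and> - 1 \<notin> Q \<and> Q0 \<subseteq> Q}"
  have "\<exists>M\<in>?F. \<forall>X\<in>?F. M \<subseteq> X \<longrightarrow> X = M"
  proof (rule subset_Zorn_nonempty)
    show "?F \<noteq> {}" using assms by auto
  next
    fix C assume C: "C \<noteq> {}" "subset.chain ?F C"
    then have qm: "\<And>Q. Q \<in> C \<Longrightarrow> quadratic_module Q \<and> - 1 \<notin> Q \<and> Q0 \<subseteq> Q"
      and lin: "\<And>P Q. P \<in> C \<Longrightarrow> Q \<in> C \<Longrightarrow> P \<subseteq> Q \<or> Q \<subseteq> P"
      by (auto simp: subset_chain_def)
    have "quadratic_module (\<Union>C)"
      unfolding quadratic_module_def
    proof (intro conjI ballI allI)
      show "1 \<in> \<Union>C" using C(1) qm quadratic_moduleD(1) by blast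
    next
      fix a b assume "a \<in> \<Union>C" "b \<in> \<Union>C"
      then obtain P Q where "P \<in> C" "Q \<in> C" "a \<in> P" "b \<in> Q" by blast
      then show "a + b \<in> \<Union>C"
        using lin[of P Q] qm quadratic_moduleD(2) by (metis UnionI subsetD)
    next
      fix x a assume "a \<in> \<Union>C"
      then show "x^2 * a \<in> \<Union>C" using qm quadratic_moduleD(3) by blast
    qed
    then show "\<Union>C \<in> ?F" using C(1) qm by blast
  qed
  then obtain Q where Q: "Q \<in> ?F" and max: "\<forall>P\<in>?F. Q \<subseteq> P \<longrightarrow> P = Q" by blast
  show thesis
  proof (rule that)
    show "P = Q" if "quadratic_module P" "- 1 \<notin> P" "Q \<subseteq> P" for P
      using max Q that by blast
  qed (use Q in auto)
qed

text \<open>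
  If neither \<open>b\<close> nor \<open>-b\<close> is in a maximal \<open>Q\<close>, adjoining either of them produces \<open>-1\<close>. Eliminating
  \<open>b\<close> from the two resulting identities shows that one of the multipliers lies in the ideal of
  \<open>quadratic_module_support_ideal\<close>, and then \<open>-1\<close> is already in \<open>Q\<close>. As admissible coefficients of
  \<open>b\<close> serve all elements \<open>t\<close> with \<open>t * Q \<subseteq> Q\<close>. They form a quadratic module inside \<open>Q\<close>, and
  unlike sums of squares they need no induction.
\<close>

lemma maximal_quadratic_module_total:
  assumes Q: "quadratic_module Q" and proper: "- 1 \<notin> Q"
    and max: "\<And>P. quadratic_module P \<Longrightarrow> - 1 \<notin> P \<Longrightarrow> Q \<subseteq> P \<Longrightarrow> P = Q"
  shows "b \<in> Q \<or> - b \<in> Q"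
proof (rule ccontr)
  assume nb: "\<not> (b \<in> Q \<or> - b \<in> Q)"
  define T where "T = {t. \<forall>q\<in>Q. t * q \<in> Q}"
  have T1: "1 \<in> T" and T_sq: "\<And>x t. t \<in> T \<Longrightarrow> x^2 * t \<in> T"
    and T_add: "\<And>s t. s \<in> T \<Longrightarrow> t \<in> T \<Longrightarrow> s + t \<in> T" and TQ: "\<And>t. t \<in> T \<Longrightarrow> t \<in> Q"
    and T_mult: "\<And>t q. t \<in> T \<Longrightarrow> q \<in> Q \<Longrightarrow> t * q \<in> Q"
    using quadratic_moduleD[OF Q] by (auto simp: T_def distrib_right mult.assoc dest: bspec[where x=1])
  have Q0: "0 \<in> Q" using quadratic_moduleD(4)[OF Q, of 0] by simp
  have T0: "0 \<in> T" using Q0 by (simp add: T_def)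
  have rep: "\<exists>q\<in>Q. \<exists>t\<in>T. - 1 = q + c * t" if "c \<notin> Q" for c
  proof -
    let ?P = "{q + c * t |q t. q \<in> Q \<and> t \<in> T}"
    have qm: "quadratic_module ?P"
      unfolding quadratic_module_def
    proof (intro conjI ballI allI)
      show "1 \<in> ?P" using quadratic_moduleD(1)[OF Q] T0 by force
    next
      fix u v assume "u \<in> ?P" "v \<in> ?P"
      then obtain q t q' t' where "u = q + c * t" "v = q' + c * t'" "q \<in> Q" "q' \<in> Q" "t \<in> T" "t' \<in> T"
        by blast
      then show "u + v \<in> ?P"
        by (intro CollectI exI[of _ "q + q'"] exI[of _ "t + t'"])
          (simp add: T_add quadratic_moduleD(2)[OF Q] algebra_simps)
    next
      fix x u assume "u \<in> ?P"
      then obtain q t where "u = q + c * t" "q \<in> Q" "t \<in> T" by blast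
      then show "x^2 * u \<in> ?P"
        by (intro CollectI exI[of _ "x^2 * q"] exI[of _ "x^2 * t"])
          (simp add: T_sq quadratic_moduleD(3)[OF Q] distrib_left mult.left_commute)
    qed
    have "Q \<subseteq> ?P" using T0 by force
    moreover have "c \<in> ?P" using Q0 T1 by force
    ultimately have "- 1 \<in> ?P" using max[OF qm] that by blast
    then show ?thesis by blast
  qed
  obtain q s where qs: "q \<in> Q" "s \<in> T" "- 1 = q + b * s" using rep[of b] nb by blast
  obtain p t where pt: "p \<in> Q" "t \<in> T" "- 1 = p + (- b) * t" using rep[of "- b"] nb by blast
  have "- s = s * p + t * q + t"
  proof -
    \<comment> \<open>cross-multiplying the two representations of \<open>-1\<close> cancels the terms with \<open>b\<close>\<close>
    have "t * (- 1) + s * (- 1) = t * (q + b * s) + s * (p + (- b) * t)" using qs(3) pt(3) by simp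
    then show ?thesis by (simp add: algebra_simps)
  qed
  then have "- s \<in> Q"
    using T_mult TQ quadratic_moduleD(2)[OF Q] qs pt by metis
  then have "b * s \<in> Q"
    using quadratic_module_support_ideal[OF Q] TQ qs(2) by blast
  then show False using qs proper quadratic_moduleD(2)[OF Q] by metis
qed

text \<open>
  A total archimedean \<open>Q\<close> is the nonnegative part of a preorder in which every element has a Dedekind
  cut by real scalars, and \<open>\<alpha> b\<close> is the position of that cut. Additivity and homogeneity are those of
  cuts. Multiplicativity reduces by polarization and by shifting \<open>b\<close> with a scalar to
  \<open>\<alpha> (b^2) = 0\<close> if \<open>\<alpha> b = 0\<close>.
\<close>

lemma character_of_total_quadratic_module:
  assumes Q: "quadratic_module Q" and proper: "- 1 \<notin> Q"
    and total: "\<And>b. b \<in> Q \<or> - b \<in> Q"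
    and arch: "\<And>b. \<exists>r. r *\<^sub>R 1 - b \<in> Q"
  obtains \<alpha> where "\<alpha> \<in> characters" "\<And>b. b \<in> Q \<Longrightarrow> 0 \<le> \<alpha> b"
proof -
  note Q_add = quadratic_moduleD(2)[OF Q]
  define \<alpha> where "\<alpha> b = Sup {r. b - r *\<^sub>R 1 \<in> Q}" for b
  have sep: "r \<le> s" if "b - r *\<^sub>R 1 \<in> Q" "s *\<^sub>R 1 - b \<in> Q" for b r s
  proof (rule ccontr)
    assume "\<not> r \<le> s"
    moreover have "(s - r) *\<^sub>R 1 \<in> Q" using Q_add[OF that] by (simp add: algebra_simps)
    ultimately show False using neg_one_in_quadratic_module[OF Q] proper by force
  qed
  have bdd: "bdd_above {r. b - r *\<^sub>R 1 \<in> Q}" for b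
    using arch[of b] sep by (auto simp: bdd_above_def)
  have ne: "{r. b - r *\<^sub>R 1 \<in> Q} \<noteq> {}" for b
  proof -
    obtain r where "r *\<^sub>R 1 - (- b) \<in> Q" using arch by blast
    then have "b - (- r) *\<^sub>R 1 \<in> Q" by (simp add: add.commute)
    then show ?thesis by blast
  qed
  have lower: "r \<le> \<alpha> b" if "b - r *\<^sub>R 1 \<in> Q" for b r
    unfolding \<alpha>_def using that by (intro cSup_upper bdd) auto
  have upper: "\<alpha> b \<le> r" if "r *\<^sub>R 1 - b \<in> Q" for b r
    unfolding \<alpha>_def using sep that by (intro cSup_least ne) auto
  have above: "r *\<^sub>R 1 - b \<in> Q" if "\<alpha> b < r" for b r
    using total[of "b - r *\<^sub>R 1"] lower[of b r] that by auto
  have below: "b - r *\<^sub>R 1 \<in> Q" if "r < \<alpha> b" for b r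
    using total[of "b - r *\<^sub>R 1"] upper[of r b] that by auto
  have unit: "\<alpha> (r *\<^sub>R 1) = r" for r
  proof -
    have "0 \<in> Q" using quadratic_moduleD(4)[OF Q, of 0] by simp
    then show ?thesis using lower[of "r *\<^sub>R 1" r] upper[of r "r *\<^sub>R 1"] by force
  qed
  have add: "\<alpha> (a + b) = \<alpha> a + \<alpha> b" for a b
  proof (rule antisym)
    show "\<alpha> (a + b) \<le> \<alpha> a + \<alpha> b"
    proof (rule field_le_epsilon)
      fix e :: real assume "0 < e"
      then have "(\<alpha> a + e/2) *\<^sub>R 1 - a \<in> Q" "(\<alpha> b + e/2) *\<^sub>R 1 - b \<in> Q" by (auto intro: above)
      from Q_add[OF this] have "(\<alpha> a + \<alpha> b + e) *\<^sub>R 1 - (a + b) \<in> Q"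
        by (simp add: scaleR_left_distrib algebra_simps flip: scaleR_left_distrib[of "e/2"])
      then show "\<alpha> (a + b) \<le> \<alpha> a + \<alpha> b + e" by (rule upper)
    qed
    show "\<alpha> a + \<alpha> b \<le> \<alpha> (a + b)"
    proof (rule field_le_epsilon)
      fix e :: real assume "0 < e"
      then have "a - (\<alpha> a - e/2) *\<^sub>R 1 \<in> Q" "b - (\<alpha> b - e/2) *\<^sub>R 1 \<in> Q" by (auto intro: below)
      from Q_add[OF this] have "(a + b) - (\<alpha> a + \<alpha> b - e) *\<^sub>R 1 \<in> Q"
        by (simp add: algebra_simps flip: scaleR_left_distrib[of "e/2"])
      then show "\<alpha> a + \<alpha> b \<le> \<alpha> (a + b) + e" using lower by force
    qed
  qed
  have minus: "\<alpha> (- b) = - \<alpha> b" for b using add[of b "- b"] unit[of 0] by simp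
  have diff: "\<alpha> (a - b) = \<alpha> a - \<alpha> b" for a b using add[of a "- b"] minus by simp
  have scale_le: "r * \<alpha> b \<le> \<alpha> (r *\<^sub>R b)" if "0 < r" for r b
  proof (rule field_le_epsilon)
    fix e :: real assume "0 < e"
    then have "b - (\<alpha> b - e / r) *\<^sub>R 1 \<in> Q" using that by (auto intro: below)
    from quadratic_module_scaleR[OF Q this, of r] have "r *\<^sub>R b - (r * \<alpha> b - e) *\<^sub>R 1 \<in> Q"
      using that by (simp add: algebra_simps)
    then show "r * \<alpha> b \<le> \<alpha> (r *\<^sub>R b) + e" using lower by force
  qed
  have scale_pos: "\<alpha> (r *\<^sub>R b) = r * \<alpha> b" if "0 < r" for r b
    using scale_le[OF that, of b] scale_le[OF that, of "- b"] minus[of b] minus[of "r *\<^sub>R b"] by simp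
  have scale: "\<alpha> (r *\<^sub>R b) = r * \<alpha> b" for r b
  proof -
    consider "r < 0" | "r = 0" | "0 < r" by linarith
    then show ?thesis
      using scale_pos[of r b] scale_pos[of "- r" b] minus[of "r *\<^sub>R b"] unit[of 0] by cases auto
  qed
  have sq0: "\<alpha> (b^2) = 0" if "\<alpha> b = 0" for b
  proof (rule antisym)
    show "0 \<le> \<alpha> (b^2)" using lower[of "b^2" 0] quadratic_moduleD(4)[OF Q] by simp
    show "\<alpha> (b^2) \<le> 0"
    proof (rule field_le_epsilon)
      fix d :: real assume "0 < d"
      define e where "e = sqrt d"
      have e: "0 < e" "e^2 = d" using \<open>0 < d\<close> by (auto simp: e_def)
      define E where "E = e *\<^sub>R (1::'a)"
      have "E - b \<in> Q" using above[of b e] that e by (simp add: E_def)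
      moreover have "E + b \<in> Q" using below[of "- e" b] that e by (simp add: E_def add.commute)
      ultimately have "(E - b)^2 * (E + b) + (E + b)^2 * (E - b) \<in> Q"
        using Q_add quadratic_moduleD(3)[OF Q] by blast
      \<comment> \<open>an expression manifestly in \<open>Q\<close> that is a positive multiple of \<open>e^2 - b^2\<close>\<close>
      also have "(E - b)^2 * (E + b) + (E + b)^2 * (E - b) = (E + E) * (E^2 - b^2)"
        by (simp add: power2_eq_square algebra_simps)
      also have "\<dots> = (2 * e) *\<^sub>R (d *\<^sub>R 1 - b^2)"
      proof -
        have "E + E = (2 * e) *\<^sub>R 1" unfolding E_def by (simp flip: scaleR_left_distrib)
        moreover have "E^2 = d *\<^sub>R 1" using e(2) by (simp add: E_def power2_eq_square)
        ultimately show ?thesis by simp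
      qed
      finally have "(1 / (2 * e)) *\<^sub>R ((2 * e) *\<^sub>R (d *\<^sub>R 1 - b^2)) \<in> Q"
        by (rule quadratic_module_scaleR[OF Q]) (use e in simp)
      then have "d *\<^sub>R 1 - b^2 \<in> Q" using e by simp
      then show "\<alpha> (b^2) \<le> 0 + d" using upper by simp
    qed
  qed
  have sq: "\<alpha> (b^2) = (\<alpha> b)^2" for b
  proof -
    define c where "c = b - \<alpha> b *\<^sub>R 1"
    have "\<alpha> c = 0" by (simp add: c_def diff unit)
    moreover have "b^2 = c^2 + (2 * \<alpha> b) *\<^sub>R c + (\<alpha> b)^2 *\<^sub>R 1"
    proof -
      have "b^2 = (c + \<alpha> b *\<^sub>R 1)^2" by (simp add: c_def)
      moreover have "(2 * \<alpha> b) *\<^sub>R c = \<alpha> b *\<^sub>R c + \<alpha> b *\<^sub>R c"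
        by (simp flip: scaleR_left_distrib)
      moreover have "(c + \<alpha> b *\<^sub>R 1)^2 = c^2 + (\<alpha> b *\<^sub>R c + \<alpha> b *\<^sub>R c) + (\<alpha> b)^2 *\<^sub>R 1"
        by (simp add: power2_eq_square distrib_left distrib_right scaleR_right_distrib)
      ultimately show ?thesis by metis
    qed
    ultimately show ?thesis using unit[of 1] by (simp add: add scale sq0)
  qed
  have mult: "\<alpha> (a * b) = \<alpha> a * \<alpha> b" for a b
  proof -
    have "(a + b)^2 = a^2 + b^2 + (a * b + a * b)"
      by (simp add: power2_eq_square distrib_left distrib_right ac_simps)
    then have "\<alpha> ((a + b)^2) = \<alpha> (a^2) + \<alpha> (b^2) + 2 * \<alpha> (a * b)" by (simp only: add mult_2)
    moreover have "\<alpha> ((a + b)^2) = (\<alpha> a)^2 + (\<alpha> b)^2 + 2 * \<alpha> a * \<alpha> b"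
      unfolding sq[of "a + b"] add by (rule power2_sum)
    ultimately show ?thesis unfolding sq by linarith
  qed
  show thesis
  proof (rule that)
    have "linear \<alpha>" by (rule linearI) (auto simp: add scale)
    then show "\<alpha> \<in> characters" using unit[of 1] mult by (simp add: characters_def)
    show "0 \<le> \<alpha> b" if "b \<in> Q" for b using lower[of b 0] that by simp
  qed
qed

text \<open>
  This is the existence part of the Kadison-Dubois representation theorem, in Jacobi's version for
  quadratic modules.
\<close>

theorem archimedean_quadratic_module_character:
  assumes "quadratic_module Q" "- 1 \<notin> Q" "\<And>b. \<exists>r. r *\<^sub>R 1 - b \<in> Q"
  obtains \<alpha> where "\<alpha> \<in> characters" "\<And>b. b \<in> Q \<Longrightarrow> 0 \<le> \<alpha> b"
proof -
  obtain P where P: "quadratic_module P" "- 1 \<notin> P" "Q \<subseteq> P"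
    "\<And>P'. quadratic_module P' \<Longrightarrow> - 1 \<notin> P' \<Longrightarrow> P \<subseteq> P' \<Longrightarrow> P' = P"
    using maximal_proper_quadratic_module[OF assms(1,2)] by blast
  have arch: "\<exists>r. r *\<^sub>R 1 - b \<in> P" for b using assms(3)[of b] P(3) by blast
  have total: "b \<in> P \<or> - b \<in> P" for b
    by (rule maximal_quadratic_module_total[OF P(1,2)]) (rule P(4))
  obtain \<alpha> where "\<alpha> \<in> characters" "\<And>b. b \<in> P \<Longrightarrow> 0 \<le> \<alpha> b"
    by (rule character_of_total_quadratic_module[OF P(1,2) total arch]) blast
  then show thesis using that P(3) by blast
qed

section \<open>The localizing module of a positive semidefinite functional\<close>

text \<open>
  Each of the defining equations involves finitely many coordinates only, so it survives pointwise
  limits.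
\<close>

lemma closed_characters: "closed (characters :: ('a::{comm_ring_1, real_algebra_1} \<Rightarrow> real) set)"
proof -
  have "characters = {\<alpha> :: 'a \<Rightarrow> real. (\<forall>a b. \<alpha> (a + b) = \<alpha> a + \<alpha> b)} \<inter>
      {\<alpha>. \<forall>r a. \<alpha> (r *\<^sub>R a) = r * \<alpha> a} \<inter> {\<alpha>. \<alpha> 1 = 1} \<inter> {\<alpha>. \<forall>a b. \<alpha> (a * b) = \<alpha> a * \<alpha> b}"
    by (auto simp: characters_def linear_iff)
  also have "closed \<dots>"
    by (intro closed_Int closed_Collect_all closed_Collect_eq continuous_intros) simp_all
  finally show ?thesis .
qed

lemma quotient_bounded_characters_subset: "quotient_bounded_characters L \<subseteq> characters"
  unfolding quotient_bounded_characters_def by (rule Collect_restrict)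

text \<open>
  The discriminant inequality, which is Cauchy-Schwarz for two fixed vectors.
\<close>

lemma square_le_of_nonneg_quadratic:
  fixes p q r :: real
  assumes nonneg: "\<And>t. 0 \<le> p + 2 * t * q + t^2 * r" and "0 \<le> r"
  shows "q^2 \<le> p * r"
proof (cases "r = 0")
  case True
  have "q = 0"
  proof (rule ccontr)
    assume "q \<noteq> 0"
    with True nonneg[of "- (p + 1) / (2 * q)"] show False by (simp add: field_simps)
  qed
  with True show ?thesis by simp
next
  case False
  then show ?thesis
    using nonneg[of "- q / r"] \<open>0 \<le> r\<close> by (simp add: field_simps power2_eq_square)
qed

text \<open>
  Its elements are those whose multiplication operator is positive in the GNS representation of \<open>L\<close>.
\<close>

definition localizing_module :: "('a::{comm_ring_1, real_algebra_1} \<Rightarrow> real) \<Rightarrow> 'a set" where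
  "localizing_module L = {a. \<forall>x. 0 \<le> L (a * x^2)}"

context
  fixes L :: "'a::{comm_ring_1, real_algebra_1} \<Rightarrow> real"
  assumes lin: "linear L" and psd: "psd_functional L"
begin

lemma quadratic_module_localizing: "quadratic_module (localizing_module L)"
proof -
  have "0 \<le> L (x^2 * a * y^2)" if "\<forall>y. 0 \<le> L (a * y^2)" for x y a
    using that[rule_format, of "x * y"] by (simp add: power_mult_distrib mult.left_commute mult.assoc)
  then show ?thesis
    using psd by (auto simp: quadratic_module_def localizing_module_def psd_functional_def
        distrib_right linear_add[OF lin])
qed

text \<open>
  For \<open>a\<close> in the localizing module, \<open>L (a * x * y)\<close> is a positive semidefinite bilinear form in
  \<open>x\<close> and \<open>y\<close>. The case \<open>a = 1\<close> is the usual inequality for \<open>L\<close>.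
\<close>

lemma localizing_Cauchy_Schwarz:
  assumes "a \<in> localizing_module L"
  shows "(L (a * x * y))^2 \<le> L (a * x^2) * L (a * y^2)"
proof (rule square_le_of_nonneg_quadratic)
  fix t
  have "a * (x + t *\<^sub>R y)^2 = a * x^2 + (2 * t) *\<^sub>R (a * x * y) + t^2 *\<^sub>R (a * y^2)"
  proof -
    have "(2 * t) *\<^sub>R (a * x * y) = t *\<^sub>R (a * x * y) + t *\<^sub>R (a * x * y)"
      by (simp flip: scaleR_left_distrib)
    then show ?thesis
      by (simp add: power2_eq_square distrib_left distrib_right ac_simps)
  qed
  then have "L (a * (x + t *\<^sub>R y)^2) = L (a * x^2) + 2 * t * L (a * x * y) + t^2 * L (a * y^2)"
    by (simp add: linear_add[OF lin] linear_scale[OF lin])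
  then show "0 \<le> L (a * x^2) + 2 * t * L (a * x * y) + t^2 * L (a * y^2)"
    using assms unfolding localizing_module_def by (metis (mono_tags) mem_Collect_eq)
qed (use assms in \<open>simp add: localizing_module_def\<close>)

text \<open>
  Because of this, the elements \<open>x\<close> that are left out of the suprema and infima would impose no further
  condition. It is the Cauchy-Schwarz inequality for \<open>L\<close> at the pair \<open>a * x\<close>, \<open>x\<close>.
\<close>

lemma L_mult_square_eq_0:
  assumes "L (x^2) = 0"
  shows "L (a * x^2) = 0"
proof -
  have "(L (a * x^2))^2 \<le> L ((a * x)^2) * L (x^2)"
    using localizing_Cauchy_Schwarz[OF quadratic_moduleD(1)[OF quadratic_module_localizing], of "a * x" x]
    by (simp add: power2_eq_square mult.assoc)
  then show ?thesis using assms by simp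
qed

lemma le_quotient_inf_iff: "ereal c \<le> quotient_inf L a \<longleftrightarrow> a - c *\<^sub>R 1 \<in> localizing_module L"
proof -
  have eq: "L ((a - c *\<^sub>R 1) * x^2) = L (a * x^2) - c * L (x^2)" for x
    by (simp add: left_diff_distrib linear_diff[OF lin] linear_scale[OF lin])
  have sq: "0 \<le> L (x^2)" for x using psd by (simp add: psd_functional_def)
  have "ereal c \<le> quotient_inf L a \<longleftrightarrow> (\<forall>x. L (x^2) \<noteq> 0 \<longrightarrow> c \<le> L (a * x^2) / L (x^2))"
    by (simp add: quotient_inf_def le_INF_iff)
  also have "\<dots> \<longleftrightarrow> (\<forall>x. c * L (x^2) \<le> L (a * x^2))"
  proof (intro all_cong1)
    fix x
    show "(L (x^2) \<noteq> 0 \<longrightarrow> c \<le> L (a * x^2) / L (x^2)) \<longleftrightarrow> c * L (x^2) \<le> L (a * x^2)"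
      using sq[of x] L_mult_square_eq_0[of x a] by (cases "L (x^2) = 0") (auto simp: pos_le_divide_eq)
  qed
  finally show ?thesis by (simp add: localizing_module_def eq)
qed

lemma quotient_sup_eq: "quotient_sup L a = - quotient_inf L (- a)"
  by (simp add: quotient_sup_def quotient_inf_def linear_neg[OF lin] flip: ereal_SUP_uminus_eq uminus_ereal.simps)

lemma quotient_sup_le_iff: "quotient_sup L a \<le> ereal c \<longleftrightarrow> c *\<^sub>R 1 - a \<in> localizing_module L"
  using le_quotient_inf_iff[of "- c" "- a"]
  by (simp add: quotient_sup_eq ereal_uminus_le_reorder)

text \<open>
  Both descriptions say that \<open>\<alpha> (a - c) \<ge> 0\<close> whenever \<open>c\<close> is a real lower bound of the quotients of
  \<open>a\<close>. The upper bounds are the lower bounds for \<open>-a\<close>.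
\<close>

lemma quotient_bounded_characters_eq:
  "quotient_bounded_characters L = {\<alpha>\<in>characters. \<forall>b\<in>localizing_module L. 0 \<le> \<alpha> b}" (is "_ = ?R")
proof (intro equalityI subsetI)
  fix \<alpha> assume "\<alpha> \<in> quotient_bounded_characters L"
  then have \<alpha>: "\<alpha> \<in> characters" and inf: "\<And>b. quotient_inf L b \<le> ereal (\<alpha> b)"
    by (auto simp: quotient_bounded_characters_def)
  have "0 \<le> \<alpha> b" if "b \<in> localizing_module L" for b
  proof -
    have "ereal 0 \<le> quotient_inf L b" unfolding le_quotient_inf_iff using that by simp
    from order_trans[OF this inf] show ?thesis by simp
  qed
  with \<alpha> show "\<alpha> \<in> ?R" by blast
next
  fix \<alpha> assume R: "\<alpha> \<in> ?R"
  then have lin\<alpha>: "linear \<alpha>" and one: "\<alpha> 1 = 1" by (auto simp: characters_def)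
  have inf: "quotient_inf L b \<le> ereal (\<alpha> b)" for b
  proof (rule ccontr)
    assume "\<not> quotient_inf L b \<le> ereal (\<alpha> b)"
    then obtain c where c: "ereal (\<alpha> b) < ereal c" "ereal c < quotient_inf L b"
      using ereal_dense2[of "ereal (\<alpha> b)" "quotient_inf L b"] by (auto simp: not_le)
    then have "b - c *\<^sub>R 1 \<in> localizing_module L" using le_quotient_inf_iff less_imp_le by blast
    then have "0 \<le> \<alpha> (b - c *\<^sub>R 1)" using R by blast
    with c(1) show False by (simp add: linear_diff[OF lin\<alpha>] linear_scale[OF lin\<alpha>] one)
  qed
  have "ereal (\<alpha> b) \<le> quotient_sup L b" for b
    using inf[of "- b"] by (metis quotient_sup_eq linear_neg[OF lin\<alpha>] ereal_minus_le_minus ereal_uminus_uminus uminus_ereal.simps(1))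
  with inf R show "\<alpha> \<in> quotient_bounded_characters L" by (auto simp: quotient_bounded_characters_def)
qed

context
  assumes unit: "L 1 = 1"
    and bounded: "\<forall>a. quotient_sup L a < \<infinity> \<and> quotient_inf L a > -\<infinity>"
begin

lemma localizing_module_archimedean: "\<exists>r. r *\<^sub>R 1 - b \<in> localizing_module L"
proof -
  have "quotient_sup L b < \<infinity>" using bounded by blast
  then obtain r where "quotient_sup L b \<le> ereal r"
    by (cases "quotient_sup L b") auto
  then show ?thesis using quotient_sup_le_iff by blast
qed

text \<open>
  Subtracting the infimum from \<open>a\<close> gives an element \<open>d\<close> of the localizing module for which \<open>0\<close> is the
  best lower bound. The character is obtained from the representation theorem after \<open>d\<close> has been
  forced to be zero by adjoining all its multiples.
\<close>

lemma quotient_inf_attained: "\<exists>\<alpha>\<in>quotient_bounded_characters L. ereal (\<alpha> a) = quotient_inf L a"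
proof -
  note Q = quadratic_module_localizing
  have sq: "0 \<le> L (x^2)" for x using psd by (simp add: psd_functional_def)
  have "quotient_inf L a \<le> ereal (L a)"
    unfolding quotient_inf_def using unit by (intro INF_lower2[of 1]) auto
  moreover have "-\<infinity> < quotient_inf L a" using bounded by blast
  ultimately obtain c where c: "quotient_inf L a = ereal c"
    by (cases "quotient_inf L a") auto
  define d where "d = a - c *\<^sub>R 1"
  have d: "d \<in> localizing_module L" using le_quotient_inf_iff[of c a] by (simp add: c d_def)
  define P where "P = {s + d * t |s t. s \<in> localizing_module L}"
  have sub: "localizing_module L \<subseteq> P"
  proof
    fix s assume "s \<in> localizing_module L"
    then show "s \<in> P" unfolding P_def by (intro CollectI exI[of _ s] exI[of _ 0]) simp
  qed
  have dP: "d * t \<in> P" for t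
  proof -
    have "0 \<in> localizing_module L" using quadratic_moduleD(4)[OF Q, of 0] by simp
    then show ?thesis unfolding P_def by force
  qed
  have P: "quadratic_module P"
    unfolding quadratic_module_def
  proof (intro conjI ballI allI)
    show "1 \<in> P" using sub quadratic_moduleD(1)[OF Q] by blast
  next
    fix u v assume "u \<in> P" "v \<in> P"
    then obtain s t s' t' where "u = s + d * t" "v = s' + d * t'"
      "s \<in> localizing_module L" "s' \<in> localizing_module L" unfolding P_def by blast
    then show "u + v \<in> P" unfolding P_def
      by (intro CollectI exI[of _ "s + s'"] exI[of _ "t + t'"])
        (simp add: quadratic_moduleD(2)[OF Q] distrib_left)
  next
    fix x u assume "u \<in> P"
    then obtain s t where "u = s + d * t" "s \<in> localizing_module L" unfolding P_def by blast
    then show "x^2 * u \<in> P" unfolding P_def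
      by (intro CollectI exI[of _ "x^2 * s"] exI[of _ "x^2 * t"])
        (simp add: quadratic_moduleD(3)[OF Q] distrib_left mult.left_commute)
  qed
  have "- 1 \<notin> P"
  proof
    assume "- 1 \<in> P"
    then obtain s t where st: "s \<in> localizing_module L" "- 1 = s + d * t" unfolding P_def by blast
    obtain r where r: "r *\<^sub>R 1 - d * t^2 \<in> localizing_module L" using localizing_module_archimedean by blast
    define N where "N = max r 1"
    have N: "0 < N" "r \<le> N" by (auto simp: N_def)
    \<comment> \<open>evaluating \<open>-1 = s + d * t\<close> at \<open>x\<close> bounds \<open>L (x^2)\<close> by \<open>-L (d * t * x^2)\<close>, to which Cauchy-Schwarz for the weight \<open>d\<close> applies\<close>
    have main: "L (x^2) \<le> N * L (d * x^2)" for x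
    proof (cases "L (x^2) = 0")
      case True
      then show ?thesis using d N by (simp add: localizing_module_def)
    next
      case False
      have "0 \<le> L ((r *\<^sub>R 1 - d * t^2) * x^2)" using r by (simp add: localizing_module_def)
      then have "L (d * t^2 * x^2) \<le> r * L (x^2)"
        by (simp add: left_diff_distrib linear_diff[OF lin] linear_scale[OF lin])
      also have "\<dots> \<le> N * L (x^2)" using N sq by (intro mult_right_mono) auto
      finally have le: "L (d * (t * x)^2) \<le> N * L (x^2)" by (simp add: power_mult_distrib mult.assoc)
      have "- (x^2) = (s + d * t) * x^2" using st(2) by (metis mult_minus1)
      then have "- L (x^2) = L (s * x^2) + L (d * t * x^2)"
        by (simp add: distrib_right linear_add[OF lin] flip: linear_neg[OF lin])
      moreover have "0 \<le> L (s * x^2)" using st(1) by (simp add: localizing_module_def)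
      ultimately have "L (x^2) \<le> - L (d * t * x^2)" by linarith
      then have "(L (x^2))^2 \<le> (L (d * t * x^2))^2"
        using sq[of x] by (metis power2_minus power_mono)
      also have "\<dots> = (L (d * (t * x) * x))^2" by (simp add: power2_eq_square[of x] mult.assoc)
      also have "\<dots> \<le> L (d * (t * x)^2) * L (d * x^2)" by (rule localizing_Cauchy_Schwarz[OF d])
      also have "\<dots> \<le> N * L (x^2) * L (d * x^2)"
        using le d by (intro mult_right_mono) (auto simp: localizing_module_def)
      finally have "L (x^2) * L (x^2) \<le> L (x^2) * (N * L (d * x^2))"
        by (simp add: power2_eq_square[of "L (x^2)"] mult_ac)
      then show ?thesis using sq[of x] False by (simp add: mult_le_cancel_left)
    qed
    \<comment> \<open>so \<open>c\<close> is not the best lower bound\<close>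
    have "a - (c + 1 / N) *\<^sub>R 1 \<in> localizing_module L"
      unfolding localizing_module_def
    proof (intro CollectI allI)
      fix x
      have "a - (c + 1 / N) *\<^sub>R 1 = d - (1 / N) *\<^sub>R 1" by (simp add: d_def scaleR_left_distrib)
      then have "L ((a - (c + 1 / N) *\<^sub>R 1) * x^2) = L (d * x^2) - L (x^2) / N"
        by (simp add: left_diff_distrib linear_diff[OF lin] linear_scale[OF lin])
      also have "0 \<le> \<dots>" using main[of x] N by (simp add: field_simps)
      finally show "0 \<le> L ((a - (c + 1 / N) *\<^sub>R 1) * x^2)" .
    qed
    then have "ereal (c + 1 / N) \<le> quotient_inf L a" using le_quotient_inf_iff by blast
    with c N show False by simp
  qed
  moreover have "\<exists>r. r *\<^sub>R 1 - b \<in> P" for b using localizing_module_archimedean sub by blast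
  ultimately obtain \<alpha> where \<alpha>: "\<alpha> \<in> characters" and pos: "\<And>b. b \<in> P \<Longrightarrow> 0 \<le> \<alpha> b"
    by (rule archimedean_quadratic_module_character[OF P]) blast
  \<comment> \<open>both \<open>d\<close> and \<open>-d\<close> have been adjoined\<close>
  have "\<alpha> d = 0"
    using pos[OF dP[of 1]] pos[OF dP[of "- 1"]] \<alpha> by (auto simp: characters_def linear_neg)
  then have "\<alpha> a = c" using \<alpha> by (simp add: d_def characters_def linear_diff linear_scale)
  moreover have "\<alpha> \<in> quotient_bounded_characters L"
    using \<alpha> pos sub by (auto simp: quotient_bounded_characters_eq)
  ultimately show ?thesis using c by auto
qed

lemma INF_quotient_bounded_characters:
  "(INF \<alpha>\<in>quotient_bounded_characters L. ereal (\<alpha> a)) = quotient_inf L a"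
proof (rule antisym)
  obtain \<alpha> where "\<alpha> \<in> quotient_bounded_characters L" "ereal (\<alpha> a) = quotient_inf L a"
    using quotient_inf_attained by blast
  then show "(INF \<alpha>\<in>quotient_bounded_characters L. ereal (\<alpha> a)) \<le> quotient_inf L a"
    by (metis INF_lower)
  show "quotient_inf L a \<le> (INF \<alpha>\<in>quotient_bounded_characters L. ereal (\<alpha> a))"
    by (rule INF_greatest) (auto simp: quotient_bounded_characters_def)
qed

lemma SUP_quotient_bounded_characters:
  "(SUP \<alpha>\<in>quotient_bounded_characters L. ereal (\<alpha> a)) = quotient_sup L a"
proof -
  have "quotient_sup L a = - (INF \<alpha>\<in>quotient_bounded_characters L. ereal (\<alpha> (- a)))"
    by (simp add: quotient_sup_eq INF_quotient_bounded_characters)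
  also have "(INF \<alpha>\<in>quotient_bounded_characters L. ereal (\<alpha> (- a))) =
      (INF \<alpha>\<in>quotient_bounded_characters L. - ereal (\<alpha> a))"
    by (rule INF_cong) (auto simp: quotient_bounded_characters_def characters_def linear_neg)
  also have "\<dots> = - (SUP \<alpha>\<in>quotient_bounded_characters L. ereal (\<alpha> a))"
    by (rule ereal_INF_uminus_eq)
  finally show ?thesis by simp
qed

lemma nonneg_of_nonneg_on_quotient_bounded_characters:
  assumes "\<And>\<alpha>. \<alpha> \<in> quotient_bounded_characters L \<Longrightarrow> 0 \<le> \<alpha> a"
  shows "0 \<le> L a"
proof -
  have "ereal 0 \<le> quotient_inf L a"
    unfolding INF_quotient_bounded_characters[symmetric] using assms by (intro INF_greatest) simp
  then have "a \<in> localizing_module L" unfolding le_quotient_inf_iff by simp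
  then have "0 \<le> L (a * 1^2)" unfolding localizing_module_def by blast
  then show ?thesis by simp
qed

text \<open>
  The bounds confine the characters to a product of compact intervals, and Tychonoff's theorem applies.
\<close>

lemma compact_quotient_bounded_characters: "compact (quotient_bounded_characters L)"
proof -
  define lo hi where "lo a = real_of_ereal (quotient_inf L a)" and "hi a = real_of_ereal (quotient_sup L a)" for a
  have box: "compact (PiE UNIV (\<lambda>a. {lo a..hi a}))"
    using compactin_PiE[of "\<lambda>a. euclideanreal" UNIV "\<lambda>a. {lo a..hi a}"]
    by (simp add: euclidean_product_topology)
  have "closed {\<alpha> :: 'a \<Rightarrow> real. \<forall>b\<in>localizing_module L. 0 \<le> \<alpha> b}"
    unfolding Ball_def
    by (intro closed_Collect_all closed_Collect_imp closed_Collect_le continuous_intros) simp_all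
  with closed_characters have "closed (characters \<inter> {\<alpha> :: 'a \<Rightarrow> real. \<forall>b\<in>localizing_module L. 0 \<le> \<alpha> b})"
    by (rule closed_Int)
  also have "characters \<inter> {\<alpha>. \<forall>b\<in>localizing_module L. 0 \<le> \<alpha> b} = quotient_bounded_characters L"
    by (auto simp: quotient_bounded_characters_eq)
  finally have closed: "closed (quotient_bounded_characters L)" .
  have "quotient_bounded_characters L \<subseteq> PiE UNIV (\<lambda>a. {lo a..hi a})"
  proof
    fix \<alpha> assume "\<alpha> \<in> quotient_bounded_characters L"
    then have "quotient_inf L a \<le> ereal (\<alpha> a)" "ereal (\<alpha> a) \<le> quotient_sup L a" for a
      by (auto simp: quotient_bounded_characters_def)
    moreover have "quotient_sup L a < \<infinity>" "- \<infinity> < quotient_inf L a" for a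
      using bounded by auto
    ultimately have "lo a \<le> \<alpha> a \<and> \<alpha> a \<le> hi a" for a
      unfolding lo_def hi_def
      by (cases "quotient_inf L a"; cases "quotient_sup L a") (force dest: spec[of _ a])+
    then show "\<alpha> \<in> PiE UNIV (\<lambda>a. {lo a..hi a})" by auto
  qed
  then show ?thesis using compact_Int_closed[OF box closed] by (simp add: Int_absorb1)
qed

end

end

section \<open>Riesz representation on a compact Hausdorff space\<close>

text \<open>
  Applied to the values of a function, this slices the function into horizontal layers of height one,
  the layer-cake decomposition by which a functional is compared with an integral below.
\<close>

lemma sum_unit_truncations:
  fixes y :: real
  assumes "0 \<le> y"
  shows "(\<Sum>k<n. min (max (y - real k) 0) 1) = min y (real n)"
proof (induction n)
  case (Suc n)
  then show ?case using assms by (auto simp: min_def max_def)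
qed (use assms in simp)

text \<open>
  A compact Hausdorff space is normal, so the general Urysohn lemma applies. It must be applied inside
  \<open>K\<close>, because the surrounding space may fail to be normal, as a product of uncountably many real lines
  does.
\<close>

lemma compact_Urysohn:
  fixes K :: "'b::t2_space set"
  assumes "compact K" "closedin (top_of_set K) C" "closedin (top_of_set K) D" "C \<inter> D = {}"
  obtains g :: "'b \<Rightarrow> real" where "continuous_on K g" "\<forall>x\<in>K. 0 \<le> g x \<and> g x \<le> 1"
    "\<forall>x\<in>C. g x = 1" "\<forall>x\<in>D. g x = 0"
proof -
  have "Hausdorff_space (euclidean :: 'b topology)"
    unfolding Hausdorff_space_def disjnt_def using hausdorff by auto
  then have "normal_space (top_of_set K)"
    using assms(1) by (intro compact_Hausdorff_or_regular_imp_normal_space)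
      (auto simp: compact_space_subtopology Hausdorff_space_subtopology)
  then obtain g where g: "continuous_map (top_of_set K) (top_of_set {0..1::real}) g" "g ` D \<subseteq> {0}" "g ` C \<subseteq> {1}"
    by (rule Urysohn_lemma[of _ D C 0 1]) (use assms in \<open>auto simp: disjnt_def\<close>)
  then have "continuous_on K g" "g ` K \<subseteq> {0..1}"
    by (auto simp: continuous_map_in_subtopology)
  with g(2,3) show thesis by (intro that[of g]) (auto simp: image_subset_iff)
qed

text \<open>
  A positive linear functional on the continuous functions on \<open>K\<close>. Functions are total on the
  surrounding type, and \<open>cong\<close> below shows that only their values on \<open>K\<close> matter.
\<close>

locale positive_functional =
  fixes K :: "'b::t2_space set" and \<Lambda> :: "('b \<Rightarrow> real) \<Rightarrow> real"
  assumes compact: "compact K"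
    and add: "continuous_on K f \<Longrightarrow> continuous_on K g \<Longrightarrow> \<Lambda> (\<lambda>x. f x + g x) = \<Lambda> f + \<Lambda> g"
    and scale: "continuous_on K f \<Longrightarrow> \<Lambda> (\<lambda>x. c * f x) = c * \<Lambda> f"
    and nonneg: "continuous_on K f \<Longrightarrow> (\<And>x. x \<in> K \<Longrightarrow> 0 \<le> f x) \<Longrightarrow> 0 \<le> \<Lambda> f"
begin

lemma mono:
  assumes "continuous_on K f" "continuous_on K g" "\<And>x. x \<in> K \<Longrightarrow> f x \<le> g x"
  shows "\<Lambda> f \<le> \<Lambda> g"
proof -
  have "0 \<le> \<Lambda> (\<lambda>x. g x + (- 1) * f x)"
    using assms by (intro nonneg continuous_intros) auto
  also have "\<dots> = \<Lambda> g + \<Lambda> (\<lambda>x. (- 1) * f x)" using assms by (intro add continuous_intros) auto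
  also have "\<Lambda> (\<lambda>x. (- 1) * f x) = (- 1) * \<Lambda> f" by (rule scale[OF assms(1)])
  finally show ?thesis by simp
qed

lemma cong:
  assumes "continuous_on K f" "continuous_on K g" "\<And>x. x \<in> K \<Longrightarrow> f x = g x"
  shows "\<Lambda> f = \<Lambda> g"
  using mono[of f g] mono[of g f] assms by force

lemma const: "\<Lambda> (\<lambda>x. c) = c * \<Lambda> (\<lambda>x. 1)"
  using scale[of "\<lambda>x. 1" c] by simp

lemma zero: "\<Lambda> (\<lambda>x. 0) = 0"
  using const[of 0] by simp

lemma sum:
  fixes n :: nat
  assumes "\<And>k. k < n \<Longrightarrow> continuous_on K (f k)"
  shows "\<Lambda> (\<lambda>x. \<Sum>k<n. f k x) = (\<Sum>k<n. \<Lambda> (f k))"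
  using assms
proof (induction n)
  case (Suc n)
  have "\<Lambda> (\<lambda>x. (\<Sum>k<n. f k x) + f n x) = \<Lambda> (\<lambda>x. \<Sum>k<n. f k x) + \<Lambda> (f n)"
    using Suc.prems by (intro add continuous_intros) auto
  with Suc show ?case by simp
qed (simp add: zero)

lemma mass_nonneg: "0 \<le> \<Lambda> (\<lambda>x. 1)"
  by (rule nonneg) auto

text \<open>
  Lowering a function by a small constant changes the functional little. The lowered function vanishes
  outside the compact set where \<open>f\<close> is at least \<open>d\<close>, so compactness arguments become available without
  speaking of supports.
\<close>

lemma cutoff:
  assumes f: "continuous_on K f" and "0 < e"
  obtains d where "0 < d" "\<Lambda> f \<le> \<Lambda> (\<lambda>x. max (f x - d) 0) + e"
proof -
  define m where "m = \<Lambda> (\<lambda>x. 1)"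
  \<comment> \<open>the summand \<open>1\<close> avoids a division by zero for the zero functional\<close>
  define d where "d = e / (m + 1)"
  have m: "0 \<le> m" using mass_nonneg by (simp add: m_def)
  have "\<Lambda> f \<le> \<Lambda> (\<lambda>x. max (f x - d) 0 + d)"
    using f by (intro mono continuous_intros) auto
  also have "\<dots> = \<Lambda> (\<lambda>x. max (f x - d) 0) + d * m"
    unfolding m_def const[of d, symmetric] using f by (intro add continuous_intros) auto
  also have "d * m \<le> e" using m \<open>0 < e\<close> by (simp add: d_def field_simps)
  finally show thesis using that[of d] m \<open>0 < e\<close> by (simp add: d_def)
qed

text \<open>
  These are the continuous functions that are dominated by the indicator of \<open>U\<close>. Requiring only
  \<open>f = 0\<close> off \<open>U\<close>, and not that the support lies in \<open>U\<close>, gives the same supremum because of \<open>cutoff\<close>.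
\<close>

definition subordinate :: "'b set \<Rightarrow> ('b \<Rightarrow> real) set" where
  "subordinate U = {f. continuous_on K f \<and> (\<forall>x\<in>K. 0 \<le> f x \<and> f x \<le> indicator U x)}"

definition open_content :: "'b set \<Rightarrow> ennreal" where
  "open_content U = (SUP f\<in>subordinate U. ennreal (\<Lambda> f))"

definition induced_outer_measure :: "'b set \<Rightarrow> ennreal" where
  "induced_outer_measure E = (INF U\<in>{U. open U \<and> E \<subseteq> U}. open_content U)"

lemma subordinateI:
  assumes "continuous_on K f" "\<And>x. x \<in> K \<Longrightarrow> 0 \<le> f x" "\<And>x. x \<in> K \<Longrightarrow> f x \<le> 1"
    "\<And>x. x \<in> K \<Longrightarrow> x \<notin> U \<Longrightarrow> f x = 0"
  shows "f \<in> subordinate U"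
  using assms by (auto simp: subordinate_def indicator_def)

lemma subordinateD:
  assumes "f \<in> subordinate U"
  shows "continuous_on K f" "\<And>x. x \<in> K \<Longrightarrow> 0 \<le> f x" "\<And>x. x \<in> K \<Longrightarrow> f x \<le> 1"
    "\<And>x. x \<in> K \<Longrightarrow> x \<notin> U \<Longrightarrow> f x = 0"
proof -
  from assms have *: "continuous_on K f" "\<And>x. x \<in> K \<Longrightarrow> 0 \<le> f x \<and> f x \<le> indicator U x"
    by (auto simp: subordinate_def)
  show "continuous_on K f" by (rule *(1))
  fix x assume x: "x \<in> K"
  show "0 \<le> f x" using *(2)[OF x] by simp
  show "f x \<le> 1" using *(2)[OF x] indicator_le_1[of U x] by (meson order_trans)
  show "f x = 0" if "x \<notin> U" using *(2)[OF x] that by simp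
qed

lemma zero_subordinate: "(\<lambda>x. 0) \<in> subordinate U"
  by (auto simp: subordinate_def)

lemma subordinate_nonempty: "subordinate U \<noteq> {}"
  using zero_subordinate by blast

lemma \<Lambda>_le_open_content: "f \<in> subordinate U \<Longrightarrow> ennreal (\<Lambda> f) \<le> open_content U"
  unfolding open_content_def by (rule SUP_upper)

lemma subordinate_mono: "U \<subseteq> V \<Longrightarrow> subordinate U \<subseteq> subordinate V"
  by (auto intro!: subordinateI dest: subordinateD)

lemma open_content_mono: "U \<subseteq> V \<Longrightarrow> open_content U \<le> open_content V"
  unfolding open_content_def by (intro SUP_subset_mono subordinate_mono) auto

lemma open_content_empty: "open_content {} = 0"
proof -
  have "\<Lambda> f = 0" if "f \<in> subordinate {}" for f
    using cong[of f "\<lambda>x. 0"] subordinateD[OF that] zero by auto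
  then have "open_content {} \<le> 0"
    unfolding open_content_def by (intro SUP_least) auto
  then show ?thesis by simp
qed

lemma open_content_UNIV: "open_content UNIV = ennreal (\<Lambda> (\<lambda>x. 1))"
proof (rule antisym)
  show "open_content UNIV \<le> ennreal (\<Lambda> (\<lambda>x. 1))"
    unfolding open_content_def by (intro SUP_least ennreal_leI mono) (auto dest: subordinateD)
  show "ennreal (\<Lambda> (\<lambda>x. 1)) \<le> open_content UNIV"
    by (intro \<Lambda>_le_open_content subordinateI) auto
qed

lemma closedin_superlevel:
  assumes "continuous_on K f"
  shows "closedin (top_of_set K) {x \<in> K. (d::real) \<le> f x}"
  using continuous_closedin_preimage[OF assms, of "{d..}"]
  by (simp add: vimage_def Int_def)

lemma compact_superlevel:
  assumes "continuous_on K f"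
  shows "compact {x \<in> K. (d::real) \<le> f x}"
  using closedin_superlevel[OF assms] compact closedin_compact by blast

text \<open>
  After a cutoff, \<open>f\<close> is carried by a compact subset of \<open>U \<union> V\<close>. The parts of this set outside \<open>U\<close>
  and outside \<open>V\<close> are disjoint and closed, and a Urysohn function for them splits \<open>f\<close> into a summand
  for \<open>U\<close> and a summand for \<open>V\<close>.
\<close>

lemma open_content_Un:
  assumes "open U" "open V"
  shows "open_content (U \<union> V) \<le> open_content U + open_content V"
  unfolding open_content_def[of "U \<union> V"]
proof (rule SUP_least, rule ennreal_le_epsilon)
  fix f and e :: real assume f: "f \<in> subordinate (U \<union> V)" and "0 < e"
  note fD = subordinateD[OF f]
  obtain d where d: "0 < d" "\<Lambda> f \<le> \<Lambda> (\<lambda>x. max (f x - d) 0) + e"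
    by (rule cutoff[OF fD(1) \<open>0 < e\<close>])
  let ?S = "{x \<in> K. d \<le> f x}"
  have closed_part: "closedin (top_of_set K) (?S - W)" if "open W" for W
  proof -
    have "closedin (top_of_set K) (?S \<inter> (K \<inter> - W))"
      using that by (intro closedin_Int[OF closedin_superlevel[OF fD(1)]] closedin_closed_Int closed_Compl)
    moreover have "?S \<inter> (K \<inter> - W) = ?S - W" by auto
    ultimately show ?thesis by simp
  qed
  have disj: "(?S - V) \<inter> (?S - U) = {}" using fD(4) d(1) by fastforce
  obtain g :: "'b \<Rightarrow> real" where g: "continuous_on K g" "\<forall>x\<in>K. 0 \<le> g x \<and> g x \<le> 1"
    "\<forall>x\<in>?S - V. g x = 1" "\<forall>x\<in>?S - U. g x = 0"
    by (rule compact_Urysohn[OF compact closed_part[OF assms(2)] closed_part[OF assms(1)] disj])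
  let ?h = "\<lambda>x. max (f x - d) 0"
  have h: "continuous_on K ?h" using fD(1) by (intro continuous_intros)
  have h01: "0 \<le> ?h x" "?h x \<le> 1" if "x \<in> K" for x using fD(3)[OF that] d(1) by auto
  have "(\<lambda>x. ?h x * g x) \<in> subordinate U"
  proof (rule subordinateI)
    show "?h x * g x = 0" if "x \<in> K" "x \<notin> U" for x using g(4) that by (cases "d \<le> f x") auto
  qed (use h h01 g(1,2) in \<open>auto intro!: continuous_intros mult_le_one\<close>)
  moreover have "(\<lambda>x. ?h x * (1 - g x)) \<in> subordinate V"
  proof (rule subordinateI)
    show "?h x * (1 - g x) = 0" if "x \<in> K" "x \<notin> V" for x using g(3) that by (cases "d \<le> f x") auto
  qed (use h h01 g(1,2) in \<open>auto intro!: continuous_intros mult_le_one\<close>)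
  ultimately have le: "ennreal (\<Lambda> (\<lambda>x. ?h x * g x)) + ennreal (\<Lambda> (\<lambda>x. ?h x * (1 - g x))) \<le>
      open_content U + open_content V"
    by (intro add_mono \<Lambda>_le_open_content)
  have "\<Lambda> ?h = \<Lambda> (\<lambda>x. ?h x * g x + ?h x * (1 - g x))" by (simp add: algebra_simps)
  also have "\<dots> = \<Lambda> (\<lambda>x. ?h x * g x) + \<Lambda> (\<lambda>x. ?h x * (1 - g x))"
    using fD(1) g(1) by (intro add continuous_intros)
  finally have "\<Lambda> f \<le> (\<Lambda> (\<lambda>x. ?h x * g x) + \<Lambda> (\<lambda>x. ?h x * (1 - g x))) + e" using d(2) by simp
  moreover have "0 \<le> \<Lambda> (\<lambda>x. ?h x * g x)" "0 \<le> \<Lambda> (\<lambda>x. ?h x * (1 - g x))"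
    using h h01 g(1,2) by (auto intro!: nonneg continuous_intros)
  ultimately have "ennreal (\<Lambda> f) \<le> ennreal (\<Lambda> (\<lambda>x. ?h x * g x)) + ennreal (\<Lambda> (\<lambda>x. ?h x * (1 - g x))) + ennreal e"
    using \<open>0 < e\<close> by (simp flip: ennreal_plus add: ennreal_leI)
  also have "\<dots> \<le> open_content U + open_content V + ennreal e" using le by (rule add_right_mono)
  finally show "ennreal (\<Lambda> f) \<le> open_content U + open_content V + ennreal e" .
qed

lemma open_content_UN_lessThan:
  assumes "\<And>i::nat. open (U i)"
  shows "open_content (\<Union>i<n. U i) \<le> (\<Sum>i<n. open_content (U i))"
proof (induction n)
  case (Suc n)
  have "open_content ((\<Union>i<n. U i) \<union> U n) \<le> open_content (\<Union>i<n. U i) + open_content (U n)"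
    using assms by (intro open_content_Un) auto
  also have "\<dots> \<le> (\<Sum>i<n. open_content (U i)) + open_content (U n)" using Suc by (rule add_right_mono)
  finally show ?case by (simp add: lessThan_Suc Un_commute add.commute)
qed (simp add: open_content_empty)

text \<open>
  After a cutoff only finitely many of the sets are needed, by compactness.
\<close>

lemma open_content_UN:
  assumes U: "\<And>i::nat. open (U i)"
  shows "open_content (\<Union>i. U i) \<le> (\<Sum>i. open_content (U i))"
  unfolding open_content_def[of "\<Union>i. U i"]
proof (rule SUP_least, rule ennreal_le_epsilon)
  fix f and e :: real assume f: "f \<in> subordinate (\<Union>i. U i)" and "0 < e"
  note fD = subordinateD[OF f]
  obtain d where d: "0 < d" "\<Lambda> f \<le> \<Lambda> (\<lambda>x. max (f x - d) 0) + e"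
    by (rule cutoff[OF fD(1) \<open>0 < e\<close>])
  have "{x \<in> K. d \<le> f x} \<subseteq> (\<Union>i. U i)" using fD(4) d(1) by fastforce
  then obtain I where I: "I \<subseteq> UNIV" "finite I" "{x \<in> K. d \<le> f x} \<subseteq> (\<Union>i\<in>I. U i)"
    by (rule compactE_image[OF compact_superlevel[OF fD(1)] U])
  then obtain n where "I \<subseteq> {..<n}" using finite_nat_iff_bounded by blast
  with I have n: "{x \<in> K. d \<le> f x} \<subseteq> (\<Union>i<n. U i)" by blast
  let ?h = "\<lambda>x. max (f x - d) 0"
  have "?h \<in> subordinate (\<Union>i<n. U i)"
  proof (rule subordinateI)
    show "continuous_on K ?h" using fD(1) by (intro continuous_intros)
    show "?h x \<le> 1" if "x \<in> K" for x using fD(3)[OF that] d(1) by auto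
    show "?h x = 0" if "x \<in> K" "x \<notin> (\<Union>i<n. U i)" for x
    proof -
      have "\<not> d \<le> f x" using n that by blast
      then show ?thesis by simp
    qed
  qed auto
  then have "ennreal (\<Lambda> ?h) \<le> open_content (\<Union>i<n. U i)" by (rule \<Lambda>_le_open_content)
  also have "\<dots> \<le> (\<Sum>i<n. open_content (U i))" by (rule open_content_UN_lessThan[OF U])
  also have "\<dots> \<le> (\<Sum>i. open_content (U i))" by (rule sum_le_suminf) auto
  finally have le: "ennreal (\<Lambda> ?h) \<le> (\<Sum>i. open_content (U i))" .
  have "0 \<le> \<Lambda> ?h" using fD(1) by (intro nonneg continuous_intros) auto
  then have "ennreal (\<Lambda> f) \<le> ennreal (\<Lambda> ?h) + ennreal e"
    using d(2) \<open>0 < e\<close> by (simp flip: ennreal_plus add: ennreal_leI)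
  also have "\<dots> \<le> (\<Sum>i. open_content (U i)) + ennreal e" using le by (rule add_right_mono)
  finally show "ennreal (\<Lambda> f) \<le> (\<Sum>i. open_content (U i)) + ennreal e" .
qed

lemma induced_outer_measure_le: "open U \<Longrightarrow> E \<subseteq> U \<Longrightarrow> induced_outer_measure E \<le> open_content U"
  unfolding induced_outer_measure_def by (rule INF_lower) auto

lemma induced_outer_measure_open: "open U \<Longrightarrow> induced_outer_measure U = open_content U"
  by (intro antisym induced_outer_measure_le)
    (auto simp: induced_outer_measure_def intro!: INF_greatest open_content_mono)

lemma induced_outer_measure_mono: "E \<subseteq> F \<Longrightarrow> induced_outer_measure E \<le> induced_outer_measure F"
  unfolding induced_outer_measure_def by (rule INF_superset_mono) auto

lemma induced_outer_measure_finite: "induced_outer_measure E < \<infinity>"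
proof -
  have "induced_outer_measure E \<le> open_content UNIV" by (rule induced_outer_measure_le) auto
  then show ?thesis by (simp add: open_content_UNIV le_less_trans)
qed

lemma induced_outer_measure_approx:
  assumes "0 < e"
  obtains U where "open U" "E \<subseteq> U" "open_content U \<le> induced_outer_measure E + ennreal e"
proof -
  have "induced_outer_measure E < induced_outer_measure E + ennreal e"
    using induced_outer_measure_finite[of E] assms by (simp add: ennreal_less_top less_top)
  then show thesis
    using that less_imp_le unfolding induced_outer_measure_def[of E] INF_less_iff by blast
qed

lemma outer_measure_space_induced: "outer_measure_space (Pow UNIV) induced_outer_measure"
proof -
  have "induced_outer_measure {} = 0"
    using induced_outer_measure_open[of "{}"] open_content_empty by simp
  moreover have "induced_outer_measure (\<Union>i. A i) \<le> (\<Sum>i. induced_outer_measure (A i))" for A :: "nat \<Rightarrow> 'b set"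
  proof (rule ennreal_le_epsilon)
    fix e :: real assume "0 < e"
    have "\<exists>U. open U \<and> A i \<subseteq> U \<and> open_content U \<le> induced_outer_measure (A i) + ennreal (e * (1/2) ^ Suc i)" for i
    proof -
      have "0 < e * (1/2) ^ Suc i" using \<open>0 < e\<close> by simp
      then obtain U where "open U" "A i \<subseteq> U" "open_content U \<le> induced_outer_measure (A i) + ennreal (e * (1/2) ^ Suc i)"
        by (rule induced_outer_measure_approx)
      then show ?thesis by blast
    qed
    then obtain U where U: "\<And>i. open (U i)" "\<And>i. A i \<subseteq> U i"
      "\<And>i. open_content (U i) \<le> induced_outer_measure (A i) + ennreal (e * (1/2) ^ Suc i)" by metis
    have "induced_outer_measure (\<Union>i. A i) \<le> open_content (\<Union>i. U i)"
      using U by (intro induced_outer_measure_le) auto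
    also have "\<dots> \<le> (\<Sum>i. open_content (U i))" by (rule open_content_UN[OF U(1)])
    also have "\<dots> \<le> (\<Sum>i. induced_outer_measure (A i) + ennreal (e * (1/2) ^ Suc i))"
      by (intro suminf_le U(3)) auto
    also have "\<dots> = (\<Sum>i. induced_outer_measure (A i)) + (\<Sum>i. ennreal e * ennreal ((1/2) ^ Suc i))"
      using \<open>0 < e\<close> by (subst suminf_add[symmetric])
        (auto simp del: ennreal_suminf_cmult simp add: ennreal_mult[symmetric])
    also have "\<dots> = (\<Sum>i. induced_outer_measure (A i)) + ennreal e"
      unfolding ennreal_suminf_cmult
      by (subst suminf_ennreal_eq[OF zero_le_power power_half_series]) auto
    finally show "induced_outer_measure (\<Union>i. A i) \<le> (\<Sum>i. induced_outer_measure (A i)) + ennreal e" .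
  qed
  ultimately show ?thesis
    by (auto simp: outer_measure_space_def positive_def increasing_def countably_subadditive_def
        induced_outer_measure_mono)
qed

text \<open>
  This is the nontrivial half of Caratheodory measurability of the open set \<open>V\<close>, tested on an open set
  \<open>W\<close>. If \<open>f\<close> nearly exhausts \<open>W \<inter> V\<close>, its cutoff lives on a compact \<open>C\<close>, and \<open>W - C\<close> is an open set
  that contains \<open>W - V\<close>. A function subordinate to \<open>W - C\<close> can be added to the cutoff of \<open>f\<close>
  without leaving the functions subordinate to \<open>W\<close>.
\<close>

lemma open_content_split:
  assumes "open W" "open V"
  shows "induced_outer_measure (W \<inter> V) + induced_outer_measure (W - V) \<le> open_content W"
proof -
  have "ennreal (\<Lambda> f) + induced_outer_measure (W - V) \<le> open_content W"
    if f: "f \<in> subordinate (W \<inter> V)" for f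
  proof (rule ennreal_le_epsilon)
    fix e :: real assume "0 < e"
    note fD = subordinateD[OF f]
    obtain d where d: "0 < d" "\<Lambda> f \<le> \<Lambda> (\<lambda>x. max (f x - d) 0) + e"
      by (rule cutoff[OF fD(1) \<open>0 < e\<close>])
    let ?C = "{x \<in> K. d \<le> f x}" and ?h = "\<lambda>x. max (f x - d) 0"
    have "closed ?C" by (intro compact_imp_closed compact_superlevel fD(1))
    then have "open (W - ?C)" using \<open>open W\<close> by (rule open_Diff[rotated])
    moreover have "W - V \<subseteq> W - ?C" using fD(4) d(1) by fastforce
    ultimately have "induced_outer_measure (W - V) \<le> open_content (W - ?C)" by (rule induced_outer_measure_le)
    then have "ennreal (\<Lambda> f) + induced_outer_measure (W - V) \<le> (SUP g\<in>subordinate (W - ?C). ennreal (\<Lambda> f) + ennreal (\<Lambda> g))"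
      unfolding ennreal_SUP_add_right[OF subordinate_nonempty, symmetric] open_content_def
      by (rule add_left_mono)
    also have "\<dots> \<le> open_content W + ennreal e"
    proof (rule SUP_least)
      fix g assume g: "g \<in> subordinate (W - ?C)"
      note gD = subordinateD[OF g]
      have h: "continuous_on K ?h" using fD(1) by (intro continuous_intros)
      have "(\<lambda>x. ?h x + g x) \<in> subordinate W"
      proof (rule subordinateI)
        show "continuous_on K (\<lambda>x. ?h x + g x)" using h gD(1) by (rule continuous_on_add)
        show "0 \<le> ?h x + g x" if "x \<in> K" for x using gD(2)[OF that] by auto
        show "?h x + g x \<le> 1" if "x \<in> K" for x
          using fD(3)[OF that] gD(3,4)[OF that] d(1) that by (cases "d \<le> f x") auto
        show "?h x + g x = 0" if "x \<in> K" "x \<notin> W" for x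
          using fD(4)[of x] gD(4)[of x] that d(1) by auto
      qed
      then have le: "ennreal (\<Lambda> (\<lambda>x. ?h x + g x)) \<le> open_content W" by (rule \<Lambda>_le_open_content)
      have "\<Lambda> (\<lambda>x. ?h x + g x) = \<Lambda> ?h + \<Lambda> g" using h gD(1) by (rule add)
      then have le2: "\<Lambda> f + \<Lambda> g \<le> \<Lambda> (\<lambda>x. ?h x + g x) + e" using d(2) by simp
      have pos: "0 \<le> \<Lambda> f" "0 \<le> \<Lambda> g" "0 \<le> \<Lambda> (\<lambda>x. ?h x + g x)"
        using fD(1,2) gD(1,2) h by (auto intro!: nonneg continuous_intros add_nonneg_nonneg)
      then have "ennreal (\<Lambda> f) + ennreal (\<Lambda> g) \<le> ennreal (\<Lambda> (\<lambda>x. ?h x + g x)) + ennreal e"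
        using le2 \<open>0 < e\<close> by (simp flip: ennreal_plus add: ennreal_leI)
      also have "\<dots> \<le> open_content W + ennreal e" using le by (rule add_right_mono)
      finally show "ennreal (\<Lambda> f) + ennreal (\<Lambda> g) \<le> open_content W + ennreal e" .
    qed
    finally show "ennreal (\<Lambda> f) + induced_outer_measure (W - V) \<le> open_content W + ennreal e" .
  qed
  then have "(SUP f\<in>subordinate (W \<inter> V). ennreal (\<Lambda> f) + induced_outer_measure (W - V)) \<le> open_content W"
    by (rule SUP_least)
  then have "open_content (W \<inter> V) + induced_outer_measure (W - V) \<le> open_content W"
    unfolding open_content_def[of "W \<inter> V"] by (simp add: ennreal_SUP_add_left[OF subordinate_nonempty])
  then show ?thesis using assms by (simp add: induced_outer_measure_open open_Int)
qed

definition induced_measure :: "'b measure" where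
  "induced_measure = measure_of UNIV (sets borel) induced_outer_measure"

lemma sets_induced_measure: "sets induced_measure = sets borel"
  unfolding induced_measure_def
  using sets.sets_measure_of_eq[of "borel :: 'b measure"] by simp

lemma emeasure_induced_measure:
  assumes "B \<in> sets borel"
  shows "emeasure induced_measure B = induced_outer_measure B"
proof -
  interpret P: sigma_algebra UNIV "Pow UNIV :: 'b set set" by (rule sigma_algebra_Pow)
  let ?S = "lambda_system UNIV (Pow UNIV) induced_outer_measure"
  have S: "measure_space UNIV ?S induced_outer_measure"
    by (rule P.caratheodory_lemma[OF outer_measure_space_induced])
  have "V \<in> ?S" if "open V" for V
  proof -
    have "induced_outer_measure (V \<inter> E) + induced_outer_measure ((UNIV - V) \<inter> E) = induced_outer_measure E" for E
    proof (rule antisym)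
      have "induced_outer_measure (E \<inter> V) + induced_outer_measure (E - V) \<le> induced_outer_measure E"
        unfolding induced_outer_measure_def[of E]
      proof (rule INF_greatest)
        fix W assume "W \<in> {W. open W \<and> E \<subseteq> W}"
        then have W: "open W" "E \<subseteq> W" by auto
        have "induced_outer_measure (E \<inter> V) + induced_outer_measure (E - V) \<le>
            induced_outer_measure (W \<inter> V) + induced_outer_measure (W - V)"
          using W by (intro add_mono induced_outer_measure_mono) auto
        also have "\<dots> \<le> open_content W" by (rule open_content_split[OF W(1) that])
        finally show "induced_outer_measure (E \<inter> V) + induced_outer_measure (E - V) \<le> open_content W" .
      qed
      moreover have "E \<inter> V = V \<inter> E" "E - V = (UNIV - V) \<inter> E" by auto
      ultimately show "induced_outer_measure (V \<inter> E) + induced_outer_measure ((UNIV - V) \<inter> E) \<le> induced_outer_measure E"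
        by simp
      have "subadditive (Pow UNIV) induced_outer_measure"
        using outer_measure_space_induced P.countably_subadditive_subadditive
        by (auto simp: outer_measure_space_def)
      then have "induced_outer_measure ((V \<inter> E) \<union> ((UNIV - V) \<inter> E)) \<le>
          induced_outer_measure (V \<inter> E) + induced_outer_measure ((UNIV - V) \<inter> E)"
        by (rule subadditiveD) auto
      moreover have "(V \<inter> E) \<union> ((UNIV - V) \<inter> E) = E" by auto
      ultimately show "induced_outer_measure E \<le> induced_outer_measure (V \<inter> E) + induced_outer_measure ((UNIV - V) \<inter> E)"
        by simp
    qed
    then show ?thesis by (simp add: lambda_system_def)
  qed
  then have "sigma_sets UNIV {V. open V} \<subseteq> ?S"
    using S by (intro sigma_algebra.sigma_sets_subset) (auto simp: measure_space_def)
  then have sub: "sets borel \<subseteq> ?S" by (simp add: borel_def)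
  have sa: "sigma_algebra UNIV (sets (borel :: 'b measure))"
    using sets.sigma_algebra_axioms[of "borel :: 'b measure"] by simp
  have "measure_space UNIV (sets borel) induced_outer_measure"
    using S sub sa by (auto simp: measure_space_def positive_def countably_additive_def subset_iff)
  then show ?thesis
    unfolding induced_measure_def using assms sa
    by (intro emeasure_measure_of_sigma) (auto simp: measure_space_def)
qed

lemma space_induced_measure: "space induced_measure = UNIV"
  using sets_eq_imp_space_eq[OF sets_induced_measure] by simp

lemma emeasure_induced_measure_open: "open U \<Longrightarrow> emeasure induced_measure U = open_content U"
  by (simp add: emeasure_induced_measure induced_outer_measure_open)

lemma finite_measure_induced: "finite_measure induced_measure"
proof
  show "emeasure induced_measure (space induced_measure) \<noteq> \<infinity>"
    by (simp add: space_induced_measure emeasure_induced_measure_open open_content_UNIV)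
qed

lemma K_borel: "K \<in> sets borel"
  using compact by (intro borel_closed compact_imp_closed)

lemma emeasure_induced_measure_Compl: "emeasure induced_measure (- K) = 0"
proof -
  have "\<Lambda> f = 0" if "f \<in> subordinate (- K)" for f
    using cong[of f "\<lambda>x. 0"] subordinateD[OF that] zero by auto
  then have "open_content (- K) \<le> 0"
    unfolding open_content_def by (intro SUP_least) auto
  moreover have "open (- K)" using compact by (simp add: compact_imp_closed open_Compl)
  ultimately show ?thesis by (simp add: emeasure_induced_measure_open)
qed

lemma AE_induced_measure: "AE x in induced_measure. x \<in> K"
proof (rule AE_I')
  show "- K \<in> null_sets induced_measure"
    using emeasure_induced_measure_Compl K_borel by (intro null_setsI) (auto simp: sets_induced_measure)
qed (auto simp: space_induced_measure)

lemma measure_induced_measure_UNIV: "measure induced_measure UNIV = \<Lambda> (\<lambda>x. 1)"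
  using mass_nonneg by (simp add: measure_def emeasure_induced_measure_open open_content_UNIV)

text \<open>
  Outer regularity holds by construction. Applied to the complement of \<open>B\<close> it gives an open \<open>U\<close>, and
  \<open>K - U\<close> is the compact subset of \<open>B\<close> that is wanted, since everything outside \<open>K\<close> is null.
\<close>

lemma induced_measure_inner_regular:
  assumes B: "B \<in> sets borel"
  shows "emeasure induced_measure B = (SUP C\<in>{C. C \<subseteq> B \<and> compact C}. emeasure induced_measure C)"
proof (rule antisym)
  interpret finite_measure induced_measure by (rule finite_measure_induced)
  note [measurable] = B K_borel and [simp] = sets_induced_measure
  show "(SUP C\<in>{C. C \<subseteq> B \<and> compact C}. emeasure induced_measure C) \<le> emeasure induced_measure B"
    by (intro SUP_least emeasure_mono) auto
  show "emeasure induced_measure B \<le> (SUP C\<in>{C. C \<subseteq> B \<and> compact C}. emeasure induced_measure C)"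
  proof (rule ennreal_le_epsilon)
    fix e :: real assume "0 < e"
    obtain U where U: "open U" "- B \<subseteq> U" "open_content U \<le> induced_outer_measure (- B) + ennreal e"
      using \<open>0 < e\<close> by (rule induced_outer_measure_approx)
    have U_borel [measurable]: "U \<in> sets borel" using U(1) by simp
    have "emeasure induced_measure (- B) + emeasure induced_measure (U - - B) = emeasure induced_measure U"
    proof -
      have "emeasure induced_measure ((- B) \<union> (U - - B)) = emeasure induced_measure (- B) + emeasure induced_measure (U - - B)"
        by (intro plus_emeasure[symmetric]) auto
      moreover have "(- B) \<union> (U - - B) = U" using U(2) by auto
      ultimately show ?thesis by simp
    qed
    also have "\<dots> \<le> emeasure induced_measure (- B) + ennreal e"
      using U by (simp add: emeasure_induced_measure_open emeasure_induced_measure)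
    finally have small: "emeasure induced_measure (U - - B) \<le> ennreal e"
      by (simp add: ennreal_add_left_cancel_le emeasure_finite)
    have C: "compact (K - U)" using compact U(1) by (rule compact_diff)
    have [measurable]: "K - U \<in> sets borel" by measurable
    have sub: "K - U \<subseteq> B" using U(2) by auto
    have "emeasure induced_measure B \<le> emeasure induced_measure ((K - U) \<union> ((U - - B) \<union> - K))"
      by (rule emeasure_mono) auto
    also have "\<dots> \<le> emeasure induced_measure (K - U) + emeasure induced_measure ((U - - B) \<union> - K)"
      by (rule emeasure_subadditive) auto
    also have "emeasure induced_measure ((U - - B) \<union> - K) \<le>
        emeasure induced_measure (U - - B) + emeasure induced_measure (- K)"
      by (rule emeasure_subadditive) auto
    also have "\<dots> \<le> ennreal e" using small by (simp add: emeasure_induced_measure_Compl)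
    also have "emeasure induced_measure (K - U) \<le> (SUP C\<in>{C. C \<subseteq> B \<and> compact C}. emeasure induced_measure C)"
      using C sub by (intro SUP_upper) auto
    finally show "emeasure induced_measure B \<le> (SUP C\<in>{C. C \<subseteq> B \<and> compact C}. emeasure induced_measure C) + ennreal e"
      by (simp add: add_left_mono add_right_mono)
  qed
qed

lemma integrable_induced_measure:
  fixes f :: "'b \<Rightarrow> real"
  assumes f: "continuous_on K f"
  shows "integrable induced_measure (\<lambda>x. indicator K x * f x)"
proof -
  interpret finite_measure induced_measure by (rule finite_measure_induced)
  have "bounded (f ` K)" using compact_continuous_image[OF f compact] by (rule compact_imp_bounded)
  then obtain B where B: "\<And>x. x \<in> K \<Longrightarrow> norm (f x) \<le> B" by (auto simp: bounded_iff)
  show ?thesis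
  proof (rule integrable_const_bound)
    show "AE x in induced_measure. norm (indicator K x * f x) \<le> B"
      using AE_induced_measure by eventually_elim (use B in auto)
    have "(\<lambda>x. indicator K x *\<^sub>R f x) \<in> borel_measurable borel"
      using K_borel f by (rule borel_measurable_continuous_on_indicator)
    then show "(\<lambda>x. indicator K x * f x) \<in> borel_measurable induced_measure"
      by (simp cong: measurable_cong_sets add: sets_induced_measure)
  qed
qed

text \<open>
  Cut \<open>n * f\<close> into layers \<open>F k\<close> between the levels \<open>k\<close> and \<open>k + 1\<close>. Each \<open>F k\<close> is subordinate to the
  set where \<open>n * f > k\<close>, so its functional is at most the measure of that set. That set in turn
  is the place where the layer below has value \<open>1\<close>, so for \<open>k > 0\<close> its measure is at most the
  integral of \<open>F (k - 1)\<close>. Summing up, the functional of \<open>f\<close> exceeds its integral by at most one layer,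
  that is by the total mass divided by \<open>n\<close>.
\<close>

lemma \<Lambda>_le_integral_unit:
  assumes f: "continuous_on K f" and f01: "\<And>x. x \<in> K \<Longrightarrow> 0 \<le> f x \<and> f x \<le> 1"
  shows "\<Lambda> f \<le> (\<integral>x. indicator K x * f x \<partial>induced_measure)"
proof (rule field_le_epsilon)
  fix e :: real assume "0 < e"
  interpret finite_measure induced_measure by (rule finite_measure_induced)
  let ?M = induced_measure
  define I where "I g = (\<integral>x. indicator K x * g x \<partial>?M)" for g :: "'b \<Rightarrow> real"
  define m where "m = \<Lambda> (\<lambda>x. 1)"
  obtain N where N: "m / e < real (Suc N)" using reals_Archimedean2 less_Suc_eq by (metis of_nat_less_iff order_less_trans lessI)
  define n where "n = Suc N"
  define F where "F k x = min (max (real n * f x - real k) 0) 1" for k x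
  have F: "continuous_on K (F k)" for k
    unfolding F_def using f by (intro continuous_intros)
  have F_sum: "(\<Sum>k<j. F k x) = min (real n * f x) (real j)" if "x \<in> K" for j x
    unfolding F_def using f01[OF that] by (intro sum_unit_truncations) simp
  have "\<exists>U. open U \<and> U \<inter> K = {x\<in>K. real k < real n * f x}" for k
  proof -
    have "continuous_on K (\<lambda>x. real n * f x)" using f by (intro continuous_intros)
    then obtain U where "open U" "U \<inter> K = (\<lambda>x. real n * f x) -` {real k<..} \<inter> K"
      unfolding continuous_on_open_invariant using open_greaterThan by blast
    then show ?thesis by (intro exI[of _ U]) auto
  qed
  then obtain U where U: "\<And>k. open (U k)" "\<And>k. U k \<inter> K = {x\<in>K. real k < real n * f x}" by metis
  have U_borel [measurable]: "U k \<in> sets ?M" for k using U(1) by (simp add: sets_induced_measure)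
  have upper: "\<Lambda> (F k) \<le> measure ?M (U k)" for k
  proof -
    have "F k \<in> subordinate (U k)"
    proof (rule subordinateI)
      show "F k x = 0" if "x \<in> K" "x \<notin> U k" for x
      proof -
        have "x \<notin> {x\<in>K. real k < real n * f x}" using that U(2)[of k] by blast
        then show ?thesis using that by (simp add: F_def)
      qed
    qed (use F in \<open>auto simp: F_def\<close>)
    then have "ennreal (\<Lambda> (F k)) \<le> emeasure ?M (U k)"
      using \<Lambda>_le_open_content U(1) by (simp add: emeasure_induced_measure_open)
    then show ?thesis by (simp add: emeasure_eq_measure)
  qed
  have lower: "measure ?M (U (Suc k)) \<le> I (F k)" for k
  proof -
    have "measure ?M (U (Suc k)) = (\<integral>x. indicator (U (Suc k)) x \<partial>?M)" by (simp add: space_induced_measure)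
    also have "\<dots> \<le> I (F k)"
      unfolding I_def
    proof (rule integral_mono_AE)
      show "integrable ?M (indicator (U (Suc k)) :: _ \<Rightarrow> real)" by (simp add: emeasure_eq_measure)
      show "integrable ?M (\<lambda>x. indicator K x * F k x)" by (rule integrable_induced_measure[OF F])
      show "AE x in ?M. indicator (U (Suc k)) x \<le> indicator K x * F k x"
        using AE_induced_measure
      proof eventually_elim
        case (elim x)
        show ?case
        proof (cases "x \<in> U (Suc k)")
          case True
          then have "real (Suc k) < real n * f x" using U(2)[of "Suc k"] elim by blast
          then show ?thesis using elim by (simp add: F_def indicator_def)
        qed (use elim in \<open>simp add: F_def\<close>)
      qed
    qed
    finally show ?thesis .
  qed
  have I_sum: "I (\<lambda>x. \<Sum>k<j. F k x) = (\<Sum>k<j. I (F k))" for j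
    unfolding I_def sum_distrib_left by (rule Bochner_Integration.integral_sum) (rule integrable_induced_measure[OF F])
  have "real n * \<Lambda> f = \<Lambda> (\<lambda>x. \<Sum>k<n. F k x)"
  proof -
    have "\<Lambda> (\<lambda>x. real n * f x) = \<Lambda> (\<lambda>x. \<Sum>k<n. F k x)"
      using f F F_sum f01 by (intro cong continuous_intros) (auto simp: min_def mult_left_le)
    then show ?thesis by (simp add: scale[OF f])
  qed
  also have "\<dots> = (\<Sum>k<n. \<Lambda> (F k))" by (rule sum) (rule F)
  also have "\<dots> \<le> (\<Sum>k<n. measure ?M (U k))" by (intro sum_mono upper)
  also have "\<dots> = measure ?M (U 0) + (\<Sum>k<N. measure ?M (U (Suc k)))"
    unfolding n_def by (rule sum.lessThan_Suc_shift)
  also have "measure ?M (U 0) \<le> m"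
    unfolding m_def measure_induced_measure_UNIV[symmetric] by (rule finite_measure_mono) (auto simp: sets_induced_measure)
  also have "(\<Sum>k<N. measure ?M (U (Suc k))) \<le> (\<Sum>k<N. I (F k))" by (intro sum_mono lower)
  also have "(\<Sum>k<N. I (F k)) = I (\<lambda>x. \<Sum>k<N. F k x)" by (rule I_sum[symmetric])
  also have "\<dots> \<le> I (\<lambda>x. real n * f x)"
    unfolding I_def
  proof (rule integral_mono_AE)
    show "integrable ?M (\<lambda>x. indicator K x * (\<Sum>k<N. F k x))"
      using F by (intro integrable_induced_measure continuous_intros)
    show "integrable ?M (\<lambda>x. indicator K x * (real n * f x))"
      using f by (intro integrable_induced_measure continuous_intros)
    show "AE x in ?M. indicator K x * (\<Sum>k<N. F k x) \<le> indicator K x * (real n * f x)"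
      using AE_induced_measure by eventually_elim (simp add: F_sum)
  qed
  also have "I (\<lambda>x. real n * f x) = real n * I f"
    unfolding I_def by (simp add: mult.left_commute)
  finally have "real n * \<Lambda> f \<le> m + real n * I f" by simp
  moreover have "m \<le> real n * e" using N \<open>0 < e\<close> by (simp add: n_def field_simps)
  ultimately have "real n * \<Lambda> f \<le> real n * (I f + e)" by (simp add: distrib_left)
  then show "\<Lambda> f \<le> (\<integral>x. indicator K x * f x \<partial>?M) + e"
    by (simp add: n_def I_def)
qed

text \<open>
  An affine change of \<open>f\<close> reduces this to values in the unit interval, because functional and measure
  have the same total mass.
\<close>

lemma \<Lambda>_le_integral:
  assumes f: "continuous_on K f"
  shows "\<Lambda> f \<le> (\<integral>x. indicator K x * f x \<partial>induced_measure)"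
proof -
  interpret finite_measure induced_measure by (rule finite_measure_induced)
  have "bounded (f ` K)" using compact_continuous_image[OF f compact] by (rule compact_imp_bounded)
  then obtain b where "0 < b" and b: "\<And>x. x \<in> K \<Longrightarrow> \<bar>f x\<bar> \<le> b"
    by (auto simp: bounded_pos)
  \<comment> \<open>\<open>f\<close> has values in \<open>[-b, b]\<close>, so \<open>g\<close> has values in \<open>[0, 1]\<close>\<close>
  define g where "g x = (f x + b) / (2 * b)" for x
  have g: "continuous_on K g" unfolding g_def using f by (intro continuous_intros) (use \<open>0 < b\<close> in auto)
  have fg: "f x = 2 * b * g x + (- b)" for x using \<open>0 < b\<close> by (simp add: g_def)
  have "\<Lambda> g \<le> (\<integral>x. indicator K x * g x \<partial>induced_measure)"
  proof (rule \<Lambda>_le_integral_unit[OF g])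
    show "0 \<le> g x \<and> g x \<le> 1" if "x \<in> K" for x using b[OF that] \<open>0 < b\<close> by (auto simp: g_def field_simps)
  qed
  then have "2 * b * \<Lambda> g \<le> 2 * b * (\<integral>x. indicator K x * g x \<partial>induced_measure)"
    using \<open>0 < b\<close> by simp
  moreover have "\<Lambda> f = 2 * b * \<Lambda> g + (- b) * \<Lambda> (\<lambda>x. 1)"
  proof -
    have "\<Lambda> f = \<Lambda> (\<lambda>x. 2 * b * g x + (- b))" by (simp only: fg[symmetric])
    also have "\<dots> = \<Lambda> (\<lambda>x. 2 * b * g x) + \<Lambda> (\<lambda>x. - b)" using g by (intro add continuous_intros)
    finally show ?thesis by (simp only: scale[OF g] const[of "- b"])
  qed
  moreover have "(\<integral>x. indicator K x * f x \<partial>induced_measure) =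
      2 * b * (\<integral>x. indicator K x * g x \<partial>induced_measure) + (- b) * \<Lambda> (\<lambda>x. 1)"
  proof -
    have "(\<integral>x. indicator K x * f x \<partial>induced_measure) =
        (\<integral>x. 2 * b * (indicator K x * g x) + (- b) \<partial>induced_measure)"
    proof (rule integral_cong_AE)
      show "AE x in induced_measure. indicator K x * f x = 2 * b * (indicator K x * g x) + (- b)"
        using AE_induced_measure by eventually_elim (simp add: fg)
    qed (use integrable_induced_measure[OF f] integrable_induced_measure[OF g] in \<open>auto intro: borel_measurable_integrable\<close>)
    also have "\<dots> = 2 * b * (\<integral>x. indicator K x * g x \<partial>induced_measure) + (- b) * measure induced_measure UNIV"
      using integrable_induced_measure[OF g] by (simp add: space_induced_measure)
    finally show ?thesis by (simp add: measure_induced_measure_UNIV)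
  qed
  ultimately show ?thesis by linarith
qed

text \<open>
  The reverse inequality is the one for \<open>-f\<close>.
\<close>

theorem \<Lambda>_eq_integral:
  assumes f: "continuous_on K f"
  shows "\<Lambda> f = (\<integral>x. indicator K x * f x \<partial>induced_measure)"
proof -
  have "\<Lambda> (\<lambda>x. (- 1) * f x) \<le> (\<integral>x. indicator K x * ((- 1) * f x) \<partial>induced_measure)"
    using f by (intro \<Lambda>_le_integral continuous_intros)
  then have "(- 1) * \<Lambda> f \<le> - (\<integral>x. indicator K x * f x \<partial>induced_measure)"
    unfolding scale[OF f] by simp
  with \<Lambda>_le_integral[OF f] show ?thesis by simp
qed

end

section \<open>Radon measures on a subspace\<close>

lemma radon_measure_on_openin:
  assumes "radon_measure_on T M" "openin T U"
  shows "U \<in> sets M"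
  using assms by (auto simp: radon_measure_on_def intro: sigma_sets.Basic)

lemma radon_measure_on_space:
  assumes "radon_measure_on T M"
  shows "space M = topspace T"
proof
  have "sets M = sigma_sets (topspace T) {U. openin T U}" using assms by (simp add: radon_measure_on_def)
  then show "space M \<subseteq> topspace T"
    using sigma_sets_into_sp[of "{U. openin T U}" "topspace T" "space M"] sets.top[of M]
    by (auto dest: openin_subset)
  show "topspace T \<subseteq> space M"
    using radon_measure_on_openin[OF assms openin_topspace] by (rule sets.sets_into_space)
qed

lemma measure_support_eq:
  "measure_support T M = topspace T - \<Union>{U. openin T U \<and> emeasure M U = 0}"
  by (auto simp: measure_support_def zero_less_iff_neq_zero)

lemma closedin_measure_support: "closedin T (measure_support T M)"
  unfolding measure_support_eq by (intro closedin_diff closedin_topspace openin_Union) auto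

text \<open>
  The complement of the support is the union of all open null sets, possibly uncountably many. A
  compact part of it is covered by finitely many of them, and inner regularity does the rest.
\<close>

lemma emeasure_Compl_measure_support:
  assumes M: "radon_measure_on T M"
  shows "emeasure M (topspace T - measure_support T M) = 0"
proof -
  let ?N = "topspace T - measure_support T M"
  have N: "?N \<in> sets M"
    using M closedin_measure_support by (intro radon_measure_on_openin) (auto intro: openin_diff)
  have "emeasure M C = 0" if C: "C \<subseteq> ?N" "compactin T C" for C
  proof -
    have "C \<subseteq> \<Union>{U. openin T U \<and> emeasure M U = 0}" using C(1) by (auto simp: measure_support_eq)
    then obtain F where F: "finite F" "F \<subseteq> {U. openin T U \<and> emeasure M U = 0}" "C \<subseteq> \<Union>F"
      using compactinD[OF C(2), of "{U. openin T U \<and> emeasure M U = 0}"] by auto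
    have "\<Union>F \<in> null_sets M"
      using null_sets_UN'[OF countable_finite[OF F(1)], of "\<lambda>U. U" M] F(2) radon_measure_on_openin[OF M]
      by (auto simp: subset_iff intro: null_setsI)
    then have "emeasure M C \<le> 0"
      using emeasure_mono[OF F(3), of M] by (simp add: null_setsD1 null_setsD2)
    then show ?thesis by simp
  qed
  then have "(SUP C\<in>{C. C \<subseteq> ?N \<and> compactin T C}. emeasure M C) \<le> 0" by (intro SUP_least) auto
  moreover have "emeasure M ?N = (SUP C\<in>{C. C \<subseteq> ?N \<and> compactin T C}. emeasure M C)"
    using M N by (simp add: radon_measure_on_def)
  ultimately show ?thesis by simp
qed

lemma sigma_sets_top_of_set:
  assumes X: "X \<in> sets borel"
  shows "sigma_sets (topspace (top_of_set X)) {U. openin (top_of_set X) U} = sets (restrict_space borel X)"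
proof -
  have "sets (restrict_space borel X) = (\<inter>) X ` sigma_sets UNIV {S. open S}"
    by (simp add: sets_restrict_space borel_def)
  also have "\<dots> = sigma_sets X ((\<inter>) X ` {S. open S})"
    using X by (intro sigma_sets_Int) (auto simp: borel_def)
  also have "(\<inter>) X ` {S. open S} = {U. openin (top_of_set X) U}"
    by (auto simp: openin_open)
  finally show ?thesis by simp
qed

lemma radon_measure_on_restrict_space:
  assumes sets: "sets M = sets borel" and "finite_measure M" and X: "X \<in> sets borel"
    and reg: "\<And>B. B \<in> sets borel \<Longrightarrow> emeasure M B = (SUP C\<in>{C. C \<subseteq> B \<and> compact C}. emeasure M C)"
  shows "radon_measure_on (top_of_set X) (restrict_space M X)"
  unfolding radon_measure_on_def sigma_sets_top_of_set[OF X]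
proof (intro conjI ballI)
  interpret finite_measure M by fact
  have X': "X \<inter> space M \<in> sets M" using X sets_eq_imp_space_eq[OF sets] sets by simp
  show sets_restrict: "sets (restrict_space M X) = sets (restrict_space borel X)"
    by (rule sets_restrict_space_cong[OF sets])
  show "\<exists>U. openin (top_of_set X) U \<and> x \<in> U \<and> emeasure (restrict_space M X) U < \<infinity>"
    if "x \<in> topspace (top_of_set X)" for x
    using that X' by (intro exI[of _ X]) (auto simp: emeasure_restrict_space less_top[symmetric])
  fix B assume "B \<in> sets (restrict_space M X)"
  then have B: "B \<in> sets borel" "B \<subseteq> X"
    using X sets_restrict by (auto simp: sets_restrict_space)
  have "emeasure (restrict_space M X) B = (SUP C\<in>{C. C \<subseteq> B \<and> compact C}. emeasure M C)"
    using B X' by (simp add: emeasure_restrict_space reg)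
  also have "\<dots> = (SUP C\<in>{C. C \<subseteq> B \<and> compactin (top_of_set X) C}. emeasure (restrict_space M X) C)"
    using B X' by (intro SUP_cong) (auto simp: compactin_subtopology emeasure_restrict_space)
  finally show "emeasure (restrict_space M X) B =
      (SUP C\<in>{C. C \<subseteq> B \<and> compactin (top_of_set X) C}. emeasure (restrict_space M X) C)" .
qed

lemma sets_radon_measure_on_top_of_set:
  assumes "radon_measure_on (top_of_set X) M" "X \<in> sets borel"
  shows "sets M = sets (restrict_space borel X)"
  using assms sigma_sets_top_of_set[of X] by (simp add: radon_measure_on_def)

lemma borel_measurable_radon:
  fixes f :: "'b::t2_space \<Rightarrow> real"
  assumes "radon_measure_on (top_of_set X) M" "X \<in> sets borel" "compact S" "continuous_on S f"
  shows "(\<lambda>x. indicator S x * f x) \<in> borel_measurable M"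
proof -
  have "(\<lambda>x. indicator S x *\<^sub>R f x) \<in> borel_measurable borel"
    using assms by (intro borel_measurable_continuous_on_indicator borel_closed compact_imp_closed)
  then have "(\<lambda>x. indicator S x * f x) \<in> borel_measurable (restrict_space borel X)"
    by (simp add: measurable_restrict_space1)
  then show ?thesis
    by (simp cong: measurable_cong_sets add: sets_radon_measure_on_top_of_set[OF assms(1,2)])
qed

lemma compact_in_radon_sets:
  fixes C :: "'b::t2_space set"
  assumes "radon_measure_on (top_of_set X) M" "X \<in> sets borel" "compact C" "C \<subseteq> X"
  shows "C \<in> sets M"
  using assms by (auto simp: sets_radon_measure_on_top_of_set sets_restrict_space
      intro!: image_eqI[of _ _ C] borel_closed compact_imp_closed)

text \<open>
  Choose a compact \<open>D\<close> disjoint from \<open>C\<close> that almost exhausts the complement of \<open>C\<close> with respect to \<open>M\<close>.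
  The integral of a Urysohn function that is \<open>1\<close> on \<open>C\<close> and \<open>0\<close> on \<open>D\<close> is, for \<open>N\<close>, at least the measure
  of \<open>C\<close>, and for \<open>M\<close> at most the measure of the complement of \<open>D\<close>, which is nearly that of \<open>C\<close>.
\<close>

lemma radon_measure_le:
  fixes X :: "'b::t2_space set"
  assumes X: "X \<in> sets borel"
    and M: "radon_measure_on (top_of_set X) M" "finite_measure M"
    and N: "radon_measure_on (top_of_set X) N" "finite_measure N"
    and mass: "measure M X = measure N X"
    and S: "compact S" "S \<subseteq> X" "AE x in M. x \<in> S" "AE x in N. x \<in> S"
    and int: "\<And>f :: 'b \<Rightarrow> real. continuous_on S f \<Longrightarrow> (\<integral>x. indicator S x * f x \<partial>M) = (\<integral>x. indicator S x * f x \<partial>N)"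
    and C: "compact C" "C \<subseteq> X"
  shows "measure N C \<le> measure M C"
proof (rule field_le_epsilon)
  fix e :: real assume "0 < e"
  interpret M: finite_measure M by (rule M(2))
  interpret N: finite_measure N by (rule N(2))
  have sp: "space M = X" "space N = X"
    using radon_measure_on_space[OF M(1)] radon_measure_on_space[OF N(1)] by simp_all
  have CM: "C \<in> sets M" and CN: "C \<in> sets N" using compact_in_radon_sets[OF _ X C] M(1) N(1) by auto
  define B where "B = X - C"
  have B: "B \<in> sets M" using CM by (simp add: B_def flip: sp(1))
  have "\<exists>D. D \<subseteq> B \<and> compactin (top_of_set X) D \<and> measure M B < measure M D + e"
  proof (rule ccontr)
    assume "\<not> ?thesis"
    then have le: "measure M D \<le> measure M B - e" if "D \<subseteq> B" "compactin (top_of_set X) D" for D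
      using that by force
    from le[of "{}"] have pos: "0 \<le> measure M B - e" by simp
    have "emeasure M B = (SUP D\<in>{D. D \<subseteq> B \<and> compactin (top_of_set X) D}. emeasure M D)"
      using M(1) B by (simp add: radon_measure_on_def)
    also have "\<dots> \<le> ennreal (measure M B - e)"
      using le by (intro SUP_least) (auto simp: M.emeasure_eq_measure ennreal_leI)
    finally show False using pos \<open>0 < e\<close> by (simp add: M.emeasure_eq_measure)
  qed
  then obtain D where "D \<subseteq> B" "compactin (top_of_set X) D" and less: "measure M B < measure M D + e" by blast
  then have D: "compact D" "D \<subseteq> X" "C \<inter> D = {}" by (auto simp: compactin_subtopology B_def)
  have DM: "D \<in> sets M" using compact_in_radon_sets[OF M(1) X D(1,2)] .
  have closed_part: "closedin (top_of_set S) (S \<inter> E)" if "compact E" for E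
    using that by (intro closedin_closed_Int compact_imp_closed)
  have disj: "(S \<inter> C) \<inter> (S \<inter> D) = {}" using D(3) by auto
  obtain f :: "'b \<Rightarrow> real" where f: "continuous_on S f" "\<forall>x\<in>S. 0 \<le> f x \<and> f x \<le> 1"
    "\<forall>x\<in>S \<inter> C. f x = 1" "\<forall>x\<in>S \<inter> D. f x = 0"
    by (rule compact_Urysohn[OF S(1) closed_part[OF C(1)] closed_part[OF D(1)] disj])
  have int_f: "integrable P (\<lambda>x. indicator S x * f x)"
    if P: "radon_measure_on (top_of_set X) P" "finite_measure P" for P
  proof (rule finite_measure.integrable_const_bound[OF P(2)])
    show "AE x in P. norm (indicator S x * f x) \<le> 1" using f(2) by (intro AE_I2) (auto simp: indicator_def)
    show "(\<lambda>x. indicator S x * f x) \<in> borel_measurable P"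
      by (rule borel_measurable_radon[OF P(1) X S(1) f(1)])
  qed
  have "measure N C = (\<integral>x. indicator C x \<partial>N)" using CN sets.sets_into_space[OF CN] by (simp add: Int_absorb2)
  also have "\<dots> \<le> (\<integral>x. indicator S x * f x \<partial>N)"
  proof (rule integral_mono_AE[OF _ int_f[OF N]])
    show "integrable N (indicator C :: 'b \<Rightarrow> real)" using CN by (simp add: N.emeasure_eq_measure)
    show "AE x in N. indicator C x \<le> indicator S x * f x"
      using S(4) by eventually_elim (use f(2,3) in \<open>auto simp: indicator_def\<close>)
  qed
  also have "\<dots> = (\<integral>x. indicator S x * f x \<partial>M)" by (rule int[OF f(1), symmetric])
  also have "\<dots> \<le> (\<integral>x. indicator (X - D) x \<partial>M)"
  proof (rule integral_mono_AE[OF int_f[OF M]])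
    show "integrable M (indicator (X - D) :: 'b \<Rightarrow> real)" using DM by (simp add: M.emeasure_eq_measure flip: sp(1))
    show "AE x in M. indicator S x * f x \<le> indicator (X - D) x"
      using S(3) by eventually_elim (use f(2,4) S(2) in \<open>auto simp: indicator_def\<close>)
  qed
  also have "\<dots> = measure M (X - D)" by (simp add: sp Int_absorb2)
  also have "\<dots> = measure M X - measure M D" using M.finite_measure_compl[OF DM] by (simp add: sp)
  also have "\<dots> \<le> measure M X - measure M B + e" using less by simp
  also have "measure M B = measure M X - measure M C" using M.finite_measure_compl[OF CM] by (simp add: sp B_def)
  finally show "measure N C \<le> measure M C + e" by simp
qed

text \<open>
  The hypotheses are symmetric in \<open>M\<close> and \<open>N\<close>, so the measures agree on compact sets and then by inner
  regularity on all measurable sets.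
\<close>

lemma radon_measure_eqI:
  fixes X :: "'b::t2_space set"
  assumes X: "X \<in> sets borel"
    and M: "radon_measure_on (top_of_set X) M" "finite_measure M"
    and N: "radon_measure_on (top_of_set X) N" "finite_measure N"
    and mass: "measure M X = measure N X"
    and S: "compact S" "S \<subseteq> X" "AE x in M. x \<in> S" "AE x in N. x \<in> S"
    and int: "\<And>f :: 'b \<Rightarrow> real. continuous_on S f \<Longrightarrow> (\<integral>x. indicator S x * f x \<partial>M) = (\<integral>x. indicator S x * f x \<partial>N)"
  shows "M = N"
proof (rule measure_eqI)
  show sets: "sets M = sets N"
    using sets_radon_measure_on_top_of_set[OF _ X] M(1) N(1) by simp
  interpret M: finite_measure M by (rule M(2))
  interpret N: finite_measure N by (rule N(2))
  have "emeasure M C = emeasure N C" if "compactin (top_of_set X) C" for C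
  proof -
    have C: "compact C" "C \<subseteq> X" using that by (auto simp: compactin_subtopology)
    have "measure N C \<le> measure M C"
      using int by (intro radon_measure_le[OF X M N mass S _ C])
    moreover have "measure M C \<le> measure N C"
      using int by (intro radon_measure_le[OF X N M mass[symmetric] S(1,2,4,3) _ C]) simp
    ultimately show ?thesis by (simp add: M.emeasure_eq_measure N.emeasure_eq_measure)
  qed
  then have "(SUP C\<in>{C. C \<subseteq> B \<and> compactin (top_of_set X) C}. emeasure M C) =
      (SUP C\<in>{C. C \<subseteq> B \<and> compactin (top_of_set X) C}. emeasure N C)" for B
    by (intro SUP_cong) auto
  then show "emeasure M B = emeasure N B" if "B \<in> sets M" for B
    using M(1) N(1) that sets by (simp add: radon_measure_on_def)
qed

section \<open>Continuous functions on compact sets of characters\<close>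

lemma characters_borel: "(characters :: ('a::{comm_ring_1, real_algebra_1} \<Rightarrow> real) set) \<in> sets borel"
  using closed_characters by (rule borel_closed)

lemma open_coordinate_vimage: "open U \<Longrightarrow> open ((\<lambda>h. h x) -` U)"
  by (rule open_vimage) simp_all

text \<open>
  A product of Hausdorff spaces is Hausdorff: points that differ in one coordinate are separated there.
  The two weaker separation classes precede, since otherwise functions would count as T0 and T1 spaces
  only for countable domain and metric range, which is too narrow for a Hausdorff instance.
\<close>

instance "fun" :: (type, t0_space) t0_space
proof
  fix f g :: "'a \<Rightarrow> 'b" assume "f \<noteq> g"
  then obtain x where "f x \<noteq> g x" by auto
  then obtain U where "open U" "\<not> (f x \<in> U \<longleftrightarrow> g x \<in> U)"
    using t0_space_class.t0_space[OF \<open>f x \<noteq> g x\<close>] by blast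
  then show "\<exists>U. open U \<and> \<not> (f \<in> U \<longleftrightarrow> g \<in> U)"
    by (intro exI[of _ "(\<lambda>h. h x) -` U"]) (auto intro: open_coordinate_vimage)
qed

instance "fun" :: (type, t1_space) t1_space
proof
  fix f g :: "'a \<Rightarrow> 'b" assume "f \<noteq> g"
  then obtain x where "f x \<noteq> g x" by auto
  then obtain U where "open U" "f x \<in> U" "g x \<notin> U"
    using t1_space_class.t1_space[OF \<open>f x \<noteq> g x\<close>] by blast
  then show "\<exists>U. open U \<and> f \<in> U \<and> g \<notin> U"
    by (intro exI[of _ "(\<lambda>h. h x) -` U"]) (auto intro: open_coordinate_vimage)
qed

instance "fun" :: (type, t2_space) t2_space
proof
  fix f g :: "'a \<Rightarrow> 'b" assume "f \<noteq> g"
  then obtain x where "f x \<noteq> g x" by auto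
  then obtain U V where "open U" "open V" "f x \<in> U" "g x \<in> V" "U \<inter> V = {}"
    using hausdorff by metis
  then show "\<exists>U V. open U \<and> open V \<and> f \<in> U \<and> g \<in> V \<and> U \<inter> V = {}"
    by (intro exI[of _ "(\<lambda>h. h x) -` U"] exI[of _ "(\<lambda>h. h x) -` V"])
      (auto intro: open_coordinate_vimage)
qed

lemma continuous_on_evaluation: "continuous_on S (\<lambda>\<alpha>. \<alpha> a :: real)"
  by (rule continuous_on_subset[OF continuous_on_product_coordinates subset_UNIV])

text \<open>
  Since characters are multiplicative, the evaluations at elements of the algebra form an algebra of
  functions on \<open>S\<close>. It contains the constants and separates points, so Stone-Weierstrass applies.
\<close>

lemma characters_dense_in_continuous:
  fixes S :: "('a::{comm_ring_1, real_algebra_1} \<Rightarrow> real) set"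
  assumes "compact S" "S \<subseteq> characters" "continuous_on S f" "0 < e"
  obtains a where "\<forall>\<alpha>\<in>S. \<bar>f \<alpha> - \<alpha> a\<bar> < e"
proof -
  define P where "P g \<longleftrightarrow> (\<exists>a. \<forall>\<alpha>\<in>S. g \<alpha> = \<alpha> a)" for g :: "('a \<Rightarrow> real) \<Rightarrow> real"
  have S: "linear \<alpha>" "\<alpha> 1 = 1" "\<alpha> (a * b) = \<alpha> a * \<alpha> b" if "\<alpha> \<in> S" for \<alpha> a b
    using that assms(2) by (auto simp: characters_def)
  have "\<exists>g. P g \<and> (\<forall>\<alpha>\<in>S. \<bar>f \<alpha> - g \<alpha>\<bar> < e)"
  proof (rule Stone_Weierstrass_HOL[OF assms(1) _ _ _ _ _ assms(3,4)])
    show "P (\<lambda>\<alpha>. c)" for c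
      unfolding P_def using S by (intro exI[of _ "c *\<^sub>R 1"]) (auto simp: linear_scale)
    show "continuous_on S g" if "P g" for g
    proof -
      from that obtain a where "\<And>\<alpha>. \<alpha> \<in> S \<Longrightarrow> g \<alpha> = \<alpha> a" unfolding P_def by blast
      then show ?thesis using continuous_on_evaluation[of S a] by (simp cong: continuous_on_cong)
    qed
    show "P (\<lambda>\<alpha>. g \<alpha> + h \<alpha>)" if gh: "P g \<and> P h" for g h
    proof -
      from gh obtain a b where "\<forall>\<alpha>\<in>S. g \<alpha> = \<alpha> a" "\<forall>\<alpha>\<in>S. h \<alpha> = \<alpha> b" unfolding P_def by blast
      then show ?thesis unfolding P_def using S by (intro exI[of _ "a + b"]) (auto simp: linear_add)
    qed
    show "P (\<lambda>\<alpha>. g \<alpha> * h \<alpha>)" if gh: "P g \<and> P h" for g h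
    proof -
      from gh obtain a b where "\<forall>\<alpha>\<in>S. g \<alpha> = \<alpha> a" "\<forall>\<alpha>\<in>S. h \<alpha> = \<alpha> b" unfolding P_def by blast
      then show ?thesis unfolding P_def using S by (intro exI[of _ "a * b"]) auto
    qed
    show "\<exists>g. P g \<and> g \<alpha> \<noteq> g \<beta>" if \<alpha>\<beta>: "\<alpha> \<in> S \<and> \<beta> \<in> S \<and> \<alpha> \<noteq> \<beta>" for \<alpha> \<beta>
    proof -
      from \<alpha>\<beta> obtain a where "\<alpha> a \<noteq> \<beta> a" by auto
      then show ?thesis unfolding P_def by (intro exI[of _ "\<lambda>\<gamma>. \<gamma> a"]) auto
    qed
  qed
  then obtain g a where "\<forall>\<alpha>\<in>S. \<bar>f \<alpha> - g \<alpha>\<bar> < e" "\<forall>\<alpha>\<in>S. g \<alpha> = \<alpha> a" unfolding P_def by blast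
  then show thesis using that[of a] by simp
qed

section \<open>Existence of a representing measure\<close>

context
  fixes L :: "'a::{comm_ring_1, real_algebra_1} \<Rightarrow> real"
  assumes lin: "linear L" and psd: "psd_functional L" and unit: "L 1 = 1"
begin

context
  assumes bounded: "\<forall>a. quotient_sup L a < \<infinity> \<and> quotient_inf L a > -\<infinity>"
begin

lemma mono_on_quotient_bounded_characters:
  assumes "\<And>\<alpha>. \<alpha> \<in> quotient_bounded_characters L \<Longrightarrow> \<alpha> a \<le> \<alpha> b + e"
  shows "L a \<le> L b + e"
proof -
  have "0 \<le> \<alpha> (b + e *\<^sub>R 1 - a)" if "\<alpha> \<in> quotient_bounded_characters L" for \<alpha>
  proof -
    have "linear \<alpha>" "\<alpha> 1 = 1"
      by (rule charactersD[OF subsetD[OF quotient_bounded_characters_subset that]])+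
    then show ?thesis using assms[OF that] by (simp add: linear_add linear_diff linear_scale)
  qed
  then have "0 \<le> L (b + e *\<^sub>R 1 - a)"
    by (rule nonneg_of_nonneg_on_quotient_bounded_characters[OF lin psd unit bounded])
  then show ?thesis by (simp add: linear_add[OF lin] linear_diff[OF lin] linear_scale[OF lin] unit)
qed

text \<open>
  This is the extension of \<open>L\<close> by continuity. The supremum over minorants gives it a value
  for every \<open>f\<close> at once, without choosing approximating sequences.
\<close>

definition continuous_extension :: "(('a \<Rightarrow> real) \<Rightarrow> real) \<Rightarrow> real" where
  "continuous_extension f = Sup {L a |a. \<forall>\<alpha>\<in>quotient_bounded_characters L. \<alpha> a \<le> f \<alpha>}"

lemma continuous_extension_approx:
  assumes "\<And>\<alpha>. \<alpha> \<in> quotient_bounded_characters L \<Longrightarrow> \<bar>f \<alpha> - \<alpha> a\<bar> \<le> e"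
  shows "\<bar>continuous_extension f - L a\<bar> \<le> e"
proof -
  let ?S = "{L a |a. \<forall>\<alpha>\<in>quotient_bounded_characters L. \<alpha> a \<le> f \<alpha>}"
  have upper: "y \<le> L a + e" if "y \<in> ?S" for y
  proof -
    from that obtain b where b: "y = L b" "\<forall>\<alpha>\<in>quotient_bounded_characters L. \<alpha> b \<le> f \<alpha>" by blast
    show ?thesis unfolding b(1)
      by (rule mono_on_quotient_bounded_characters) (use b(2) assms in force)
  qed
  have mem: "L a - e \<in> ?S"
  proof (intro CollectI exI[of _ "a - e *\<^sub>R 1"] conjI ballI)
    show "L a - e = L (a - e *\<^sub>R 1)" by (simp add: linear_diff[OF lin] linear_scale[OF lin] unit)
    fix \<alpha> assume \<alpha>: "\<alpha> \<in> quotient_bounded_characters L"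
    then have "linear \<alpha>" "\<alpha> 1 = 1"
      by (auto intro: charactersD subsetD[OF quotient_bounded_characters_subset])
    then show "\<alpha> (a - e *\<^sub>R 1) \<le> f \<alpha>" using assms[OF \<alpha>] by (simp add: linear_diff linear_scale abs_le_iff)
  qed
  have "Sup ?S \<le> L a + e" using mem by (intro cSup_least upper) auto
  moreover have "L a - e \<le> Sup ?S"
    using mem upper by (intro cSup_upper bdd_aboveI)
  ultimately show ?thesis by (simp add: continuous_extension_def abs_le_iff)
qed

lemma quotient_bounded_characters_dense:
  assumes "continuous_on (quotient_bounded_characters L) f" "0 < e"
  obtains a where "\<forall>\<alpha>\<in>quotient_bounded_characters L. \<bar>f \<alpha> - \<alpha> a\<bar> < e"
  by (rule characters_dense_in_continuous
      [OF compact_quotient_bounded_characters[OF lin psd unit bounded] _ assms])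
    (rule quotient_bounded_characters_subset)

text \<open>
  Linearity and positivity of \<open>L\<close> carry over to the extension in the limit, since every continuous
  function is uniformly close to the evaluation at some element of the algebra.
\<close>

lemma positive_functional_continuous_extension:
  "positive_functional (quotient_bounded_characters L) continuous_extension"
proof
  let ?K = "quotient_bounded_characters L" and ?\<Lambda> = continuous_extension
  have K: "linear \<alpha>" if "\<alpha> \<in> ?K" for \<alpha>
    by (rule charactersD[OF subsetD[OF quotient_bounded_characters_subset that]])
  show "compact ?K" by (rule compact_quotient_bounded_characters[OF lin psd unit bounded])
  show "?\<Lambda> (\<lambda>x. f x + g x) = ?\<Lambda> f + ?\<Lambda> g" if f: "continuous_on ?K f" and g: "continuous_on ?K g" for f g
  proof -
    have "\<bar>?\<Lambda> (\<lambda>x. f x + g x) - (?\<Lambda> f + ?\<Lambda> g)\<bar> \<le> 0 + e" if "0 < e" for e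
    proof -
      have e: "0 < e / 4" using that by simp
      obtain a where a: "\<forall>\<alpha>\<in>?K. \<bar>f \<alpha> - \<alpha> a\<bar> < e / 4"
        using quotient_bounded_characters_dense[OF f e] .
      obtain b where b: "\<forall>\<alpha>\<in>?K. \<bar>g \<alpha> - \<alpha> b\<bar> < e / 4"
        using quotient_bounded_characters_dense[OF g e] .
      have "\<bar>f \<alpha> + g \<alpha> - \<alpha> (a + b)\<bar> \<le> e / 2" if "\<alpha> \<in> ?K" for \<alpha>
        using bspec[OF a that] bspec[OF b that] unfolding linear_add[OF K[OF that]] by linarith
      from continuous_extension_approx[of "\<lambda>\<alpha>. f \<alpha> + g \<alpha>", OF this]
      have "\<bar>?\<Lambda> (\<lambda>x. f x + g x) - L (a + b)\<bar> \<le> e / 2" .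
      moreover have "\<bar>?\<Lambda> f - L a\<bar> \<le> e / 4" using a by (intro continuous_extension_approx) (auto intro: less_imp_le)
      moreover have "\<bar>?\<Lambda> g - L b\<bar> \<le> e / 4" using b by (intro continuous_extension_approx) (auto intro: less_imp_le)
      ultimately show ?thesis unfolding linear_add[OF lin] by linarith
    qed
    from field_le_epsilon[OF this] show ?thesis by simp
  qed
  show "?\<Lambda> (\<lambda>x. c * f x) = c * ?\<Lambda> f" if f: "continuous_on ?K f" for f c
  proof -
    have "\<bar>?\<Lambda> (\<lambda>x. c * f x) - c * ?\<Lambda> f\<bar> \<le> 0 + e" if "0 < e" for e
    proof -
      define d where "d = e / (2 * (\<bar>c\<bar> + 1))"
      have d: "0 < d" "\<bar>c\<bar> * d \<le> e / 2" using that by (simp_all add: d_def field_simps)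
      obtain a where a: "\<forall>\<alpha>\<in>?K. \<bar>f \<alpha> - \<alpha> a\<bar> < d"
        using quotient_bounded_characters_dense[OF f d(1)] .
      have "\<bar>c * f \<alpha> - \<alpha> (c *\<^sub>R a)\<bar> \<le> \<bar>c\<bar> * d" if "\<alpha> \<in> ?K" for \<alpha>
      proof -
        have "\<bar>c * f \<alpha> - \<alpha> (c *\<^sub>R a)\<bar> = \<bar>c\<bar> * \<bar>f \<alpha> - \<alpha> a\<bar>"
          by (simp add: linear_scale[OF K[OF that]] flip: abs_mult right_diff_distrib)
        also have "\<dots> \<le> \<bar>c\<bar> * d" using bspec[OF a that] by (intro mult_left_mono) auto
        finally show ?thesis .
      qed
      from continuous_extension_approx[of "\<lambda>\<alpha>. c * f \<alpha>", OF this]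
      have "\<bar>?\<Lambda> (\<lambda>x. c * f x) - c * L a\<bar> \<le> \<bar>c\<bar> * d" by (simp add: linear_scale[OF lin])
      moreover have "\<bar>c * ?\<Lambda> f - c * L a\<bar> \<le> \<bar>c\<bar> * d"
      proof -
        have "\<bar>?\<Lambda> f - L a\<bar> \<le> d" using a by (intro continuous_extension_approx) (auto intro: less_imp_le)
        then have "\<bar>c\<bar> * \<bar>?\<Lambda> f - L a\<bar> \<le> \<bar>c\<bar> * d" by (intro mult_left_mono) auto
        then show ?thesis by (simp flip: abs_mult right_diff_distrib)
      qed
      ultimately show ?thesis using d(2) by linarith
    qed
    from field_le_epsilon[OF this] show ?thesis by simp
  qed
  show "0 \<le> ?\<Lambda> f" if f: "continuous_on ?K f" and f0: "\<And>x. x \<in> ?K \<Longrightarrow> 0 \<le> f x" for f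
  proof (rule field_le_epsilon)
    fix e :: real assume "0 < e"
    then have e: "0 < e / 2" by simp
    obtain a where a: "\<forall>\<alpha>\<in>?K. \<bar>f \<alpha> - \<alpha> a\<bar> < e / 2"
      using quotient_bounded_characters_dense[OF f e] .
    have "\<bar>?\<Lambda> f - L a\<bar> \<le> e / 2" using a by (intro continuous_extension_approx) (auto intro: less_imp_le)
    moreover have "L 0 \<le> L a + e / 2"
    proof (rule mono_on_quotient_bounded_characters)
      show "\<alpha> 0 \<le> \<alpha> a + e / 2" if "\<alpha> \<in> ?K" for \<alpha>
        using bspec[OF a that] f0[OF that] unfolding linear_0[OF K[OF that]] by linarith
    qed
    ultimately show "0 \<le> ?\<Lambda> f + e" unfolding linear_0[OF lin] by linarith
  qed
qed

text \<open>
  The Riesz measure lives on the whole function space. As it is carried by a compact set of characters,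
  it may be restricted to the closed set of all characters without changing integrals.
\<close>

lemma representing_measure_exists:
  obtains M where "representing_measure L M"
    "emeasure M (characters - quotient_bounded_characters L) = 0"
proof -
  let ?K = "quotient_bounded_characters L"
  interpret positive_functional ?K continuous_extension
    by (rule positive_functional_continuous_extension)
  interpret finite_measure induced_measure by (rule finite_measure_induced)
  define M where "M = restrict_space induced_measure (characters :: ('a \<Rightarrow> real) set)"
  have X: "(characters :: ('a \<Rightarrow> real) set) \<in> sets borel" using closed_characters by (rule borel_closed)
  have X': "characters \<inter> space induced_measure \<in> sets induced_measure"
    using X by (simp add: space_induced_measure sets_induced_measure)
  have KX: "?K \<subseteq> characters" by (rule quotient_bounded_characters_subset)
  have radon: "radon_measure_on character_space M"
    unfolding M_def
    by (rule radon_measure_on_restrict_space[OF sets_induced_measure finite_measure_induced X induced_measure_inner_regular])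
  have null: "emeasure M (characters - ?K) = 0"
  proof -
    have "emeasure induced_measure (characters - ?K) \<le> emeasure induced_measure (- ?K)"
      using K_borel by (intro emeasure_mono) (auto simp: sets_induced_measure)
    then show ?thesis using X' by (simp add: M_def emeasure_restrict_space emeasure_induced_measure_Compl)
  qed
  have "integrable M (\<lambda>\<alpha>. \<alpha> a) \<and> L a = (\<integral>\<alpha>. \<alpha> a \<partial>M)" for a
  proof -
    let ?f = "\<lambda>\<alpha>::'a \<Rightarrow> real. \<alpha> a"
    have intK: "integrable induced_measure (\<lambda>\<alpha>. indicator ?K \<alpha> * ?f \<alpha>)"
      by (rule integrable_induced_measure[OF continuous_on_evaluation])
    have "?f \<in> borel_measurable induced_measure"
      using borel_measurable_continuous_onI[OF continuous_on_evaluation]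
      by (simp cong: measurable_cong_sets add: sets_induced_measure)
    then have meas: "(\<lambda>\<alpha>. indicator characters \<alpha> *\<^sub>R ?f \<alpha>) \<in> borel_measurable induced_measure"
      using X by (intro borel_measurable_scaleR borel_measurable_indicator) (simp_all add: sets_induced_measure)
    have AE: "AE \<alpha> in induced_measure. indicator ?K \<alpha> * ?f \<alpha> = indicator characters \<alpha> *\<^sub>R ?f \<alpha>"
      using AE_induced_measure by eventually_elim (use KX in \<open>auto simp: indicator_def\<close>)
    have "integrable induced_measure (\<lambda>\<alpha>. indicator characters \<alpha> *\<^sub>R ?f \<alpha>)"
      by (rule integrable_cong_AE_imp[OF intK meas AE])
    moreover have "L a = (\<integral>\<alpha>. indicator characters \<alpha> *\<^sub>R ?f \<alpha> \<partial>induced_measure)"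
    proof -
      have "\<bar>continuous_extension ?f - L a\<bar> \<le> 0" by (rule continuous_extension_approx) simp
      then have "L a = (\<integral>\<alpha>. indicator ?K \<alpha> * ?f \<alpha> \<partial>induced_measure)"
        using \<Lambda>_eq_integral[OF continuous_on_evaluation] by simp
      also have "\<dots> = (\<integral>\<alpha>. indicator characters \<alpha> *\<^sub>R ?f \<alpha> \<partial>induced_measure)"
        by (rule integral_cong_AE[OF borel_measurable_integrable[OF intK] meas AE])
      finally show ?thesis .
    qed
    ultimately show ?thesis
      using X' by (simp add: M_def integral_restrict_space integrable_restrict_space)
  qed
  with radon null show thesis using that[of M] by (simp add: representing_measure_def)
qed

end

end

section \<open>Uniqueness and the bounds forced by compact support\<close>

context
  fixes L :: "'a::{comm_ring_1, real_algebra_1} \<Rightarrow> real"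
  assumes lin: "linear L" and psd: "psd_functional L" and unit: "L 1 = 1"
begin

lemma representing_measureD:
  assumes "representing_measure L M"
  shows "radon_measure_on character_space M" "space M = characters"
    "integrable M (\<lambda>\<alpha>. \<alpha> a)" "L a = (\<integral>\<alpha>. \<alpha> a \<partial>M)"
  using assms radon_measure_on_space[of character_space M] by (auto simp: representing_measure_def)

lemma representing_measure_mass:
  assumes M: "representing_measure L M"
  shows "finite_measure M" "measure M characters = 1"
proof -
  note MD = representing_measureD[OF M]
  have one: "\<alpha> 1 = indicator characters \<alpha>" if "\<alpha> \<in> space M" for \<alpha>
    using that charactersD(2) by (simp add: MD(2))
  have "integrable M (indicator characters :: _ \<Rightarrow> real)"
    using MD(3)[of 1] one by (simp cong: Bochner_Integration.integrable_cong)
  then have "emeasure M characters < \<infinity>" by (simp add: integrable_indicator_iff flip: MD(2))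
  then show "finite_measure M" by (intro finite_measureI) (simp add: MD(2))
  have "1 = (\<integral>\<alpha>. \<alpha> 1 \<partial>M)" using MD(4)[of 1] unit by simp
  also have "\<dots> = (\<integral>\<alpha>. indicator characters \<alpha> \<partial>M)"
    using one by (rule Bochner_Integration.integral_cong[OF refl])
  also have "\<dots> = measure M characters" by (simp flip: MD(2))
  finally show "measure M characters = 1" by simp
qed

lemma AE_measure_support:
  assumes M: "representing_measure L M"
  shows "AE \<alpha> in M. \<alpha> \<in> measure_support character_space M"
proof -
  note MD = representing_measureD[OF M]
  have "openin character_space (topspace character_space - measure_support character_space M)"
    using closedin_measure_support by blast
  from radon_measure_on_openin[OF MD(1) this] emeasure_Compl_measure_support[OF MD(1)]
  have "characters - measure_support character_space M \<in> null_sets M" by (intro null_setsI) simp_all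
  then show ?thesis by (rule AE_I') (auto simp: MD(2))
qed

text \<open>
  The integral of a continuous function is determined by \<open>L\<close> up to the error with which the function is
  approximated by an element of the algebra.
\<close>

lemma representing_integral_approx:
  assumes M: "representing_measure L M" and S: "compact S" "AE \<alpha> in M. \<alpha> \<in> S"
    and f: "continuous_on S f" "\<forall>\<alpha>\<in>S. \<bar>f \<alpha> - \<alpha> a\<bar> < e"
  shows "\<bar>(\<integral>\<alpha>. indicator S \<alpha> * f \<alpha> \<partial>M) - L a\<bar> \<le> e"
proof -
  note MD = representing_measureD[OF M]
  interpret finite_measure M by (rule representing_measure_mass(1)[OF M])
  have "bounded (f ` S)" using compact_continuous_image[OF f(1) S(1)] by (rule compact_imp_bounded)
  then obtain b where b: "\<forall>\<alpha>\<in>S. norm (f \<alpha>) \<le> b" by (auto simp: bounded_iff)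
  have int: "integrable M (\<lambda>\<alpha>. indicator S \<alpha> * f \<alpha>)"
  proof (rule integrable_const_bound)
    show "AE \<alpha> in M. norm (indicator S \<alpha> * f \<alpha>) \<le> b" using S(2) by eventually_elim (use b in auto)
    show "(\<lambda>\<alpha>. indicator S \<alpha> * f \<alpha>) \<in> borel_measurable M"
      by (rule borel_measurable_radon[OF MD(1) characters_borel S(1) f(1)])
  qed
  have mass: "(\<integral>\<alpha>. e \<partial>M) = e" using representing_measure_mass(2)[OF M] by (simp add: MD(2))
  have "(\<integral>\<alpha>. indicator S \<alpha> * f \<alpha> \<partial>M) \<le> (\<integral>\<alpha>. \<alpha> a + e \<partial>M)"
  proof (rule integral_mono_AE[OF int])
    show "integrable M (\<lambda>\<alpha>. \<alpha> a + e)" using MD(3) by simp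
    show "AE \<alpha> in M. indicator S \<alpha> * f \<alpha> \<le> \<alpha> a + e"
      using S(2) by eventually_elim (use f(2) in force)
  qed
  also have "\<dots> = L a + e" using MD(3,4) mass by simp
  finally have upper: "(\<integral>\<alpha>. indicator S \<alpha> * f \<alpha> \<partial>M) \<le> L a + e" .
  have "L a - e = (\<integral>\<alpha>. \<alpha> a - e \<partial>M)" using MD(3,4) mass by simp
  also have "\<dots> \<le> (\<integral>\<alpha>. indicator S \<alpha> * f \<alpha> \<partial>M)"
  proof (rule integral_mono_AE[OF _ int])
    show "integrable M (\<lambda>\<alpha>. \<alpha> a - e)" using MD(3) by simp
    show "AE \<alpha> in M. \<alpha> a - e \<le> indicator S \<alpha> * f \<alpha>"
      using S(2) by eventually_elim (use f(2) in force)
  qed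
  finally show ?thesis using upper by linarith
qed

lemma representing_measure_unique:
  assumes M: "representing_measure L M" "compactin character_space (measure_support character_space M)"
    and N: "representing_measure L N" "compactin character_space (measure_support character_space N)"
  shows "M = N"
proof -
  define S where "S = measure_support character_space M \<union> measure_support character_space N"
  have S: "compact S" "S \<subseteq> characters" using M(2) N(2) by (auto simp: S_def compactin_subtopology)
  have AE: "AE \<alpha> in M. \<alpha> \<in> S" "AE \<alpha> in N. \<alpha> \<in> S"
    using AE_measure_support[OF M(1)] AE_measure_support[OF N(1)] by (auto simp: S_def elim: eventually_mono)
  note massM = representing_measure_mass[OF M(1)] and massN = representing_measure_mass[OF N(1)]
  show ?thesis
  proof (rule radon_measure_eqI[OF characters_borel])
    show "radon_measure_on character_space M" "radon_measure_on character_space N"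
      using representing_measureD(1) M(1) N(1) by blast+
    show "(\<integral>\<alpha>. indicator S \<alpha> * f \<alpha> \<partial>M) = (\<integral>\<alpha>. indicator S \<alpha> * f \<alpha> \<partial>N)" (is "?I = ?J")
      if f: "continuous_on S f" for f :: "('a \<Rightarrow> real) \<Rightarrow> real"
    proof -
      have "\<bar>?I - ?J\<bar> \<le> 0 + e" if "0 < e" for e
      proof -
        have e: "0 < e / 2" using that by simp
        obtain a where a: "\<forall>\<alpha>\<in>S. \<bar>f \<alpha> - \<alpha> a\<bar> < e / 2"
          by (rule characters_dense_in_continuous[OF S f e])
        show ?thesis
          using representing_integral_approx[OF M(1) S(1) AE(1) f a]
            representing_integral_approx[OF N(1) S(1) AE(2) f a] by linarith
      qed
      from field_le_epsilon[OF this] show ?thesis by simp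
    qed
  qed (use S AE massM massN in simp_all)
qed

text \<open>
  A character that is nonnegative at \<open>b\<close> is nonnegative at \<open>b * x^2\<close>, so \<open>L (b * x^2)\<close> is the integral of an almost
  everywhere nonnegative function.
\<close>

lemma localizing_module_of_nonneg_on_support:
  assumes M: "representing_measure L M"
    and nonneg: "\<forall>\<alpha>\<in>measure_support character_space M. 0 \<le> \<alpha> b"
  shows "b \<in> localizing_module L"
  unfolding localizing_module_def
proof (intro CollectI allI)
  fix x
  have "0 \<le> (\<integral>\<alpha>. \<alpha> (b * x^2) \<partial>M)"
  proof (rule integral_nonneg_AE)
    show "AE \<alpha> in M. 0 \<le> \<alpha> (b * x^2)"
      using AE_measure_support[OF M]
    proof eventually_elim
      case (elim \<alpha>)
      then have "\<alpha> \<in> characters" by (simp add: measure_support_def)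
      then have "\<alpha> (b * x^2) = \<alpha> b * (\<alpha> x)^2" by (simp add: charactersD(3) power2_eq_square)
      then show ?case using nonneg elim by simp
    qed
  qed
  then show "0 \<le> L (b * x^2)" using representing_measureD(4)[OF M] by simp
qed

lemma bounded_of_compact_support:
  assumes M: "representing_measure L M"
    and compact: "compactin character_space (measure_support character_space M)"
  shows "quotient_sup L a < \<infinity> \<and> quotient_inf L a > -\<infinity>"
proof -
  let ?S = "measure_support character_space M"
  have S: "compact ?S" "?S \<subseteq> characters" using compact by (auto simp: compactin_subtopology)
  have "bounded ((\<lambda>\<alpha>. \<alpha> a) ` ?S)"
    by (intro compact_imp_bounded compact_continuous_image continuous_on_evaluation S)
  then obtain r where r: "\<forall>\<alpha>\<in>?S. \<bar>\<alpha> a\<bar> \<le> r" by (auto simp: bounded_iff)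
  have eval: "\<alpha> (r *\<^sub>R 1 - a) = r - \<alpha> a" "\<alpha> (a - (- r) *\<^sub>R 1) = \<alpha> a + r" if "\<alpha> \<in> ?S" for \<alpha>
  proof -
    note \<alpha> = charactersD[OF subsetD[OF S(2) that]]
    show "\<alpha> (r *\<^sub>R 1 - a) = r - \<alpha> a" "\<alpha> (a - (- r) *\<^sub>R 1) = \<alpha> a + r"
      unfolding linear_diff[OF \<alpha>(1)] linear_scale[OF \<alpha>(1)] \<alpha>(2) by simp_all
  qed
  have "r *\<^sub>R 1 - a \<in> localizing_module L"
  proof (rule localizing_module_of_nonneg_on_support[OF M], rule ballI)
    show "0 \<le> \<alpha> (r *\<^sub>R 1 - a)" if "\<alpha> \<in> ?S" for \<alpha> using eval(1)[OF that] bspec[OF r that] by linarith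
  qed
  then have "quotient_sup L a \<le> ereal r" unfolding quotient_sup_le_iff[OF lin psd] .
  moreover have "a - (- r) *\<^sub>R 1 \<in> localizing_module L"
  proof (rule localizing_module_of_nonneg_on_support[OF M], rule ballI)
    show "0 \<le> \<alpha> (a - (- r) *\<^sub>R 1)" if "\<alpha> \<in> ?S" for \<alpha> using eval(2)[OF that] bspec[OF r that] by linarith
  qed
  then have "ereal (- r) \<le> quotient_inf L a" unfolding le_quotient_inf_iff[OF lin psd] .
  ultimately show ?thesis
    by (auto intro: le_less_trans[of _ "ereal r"] less_le_trans[of _ "ereal (- r)"])
qed

text \<open>
  The complement of \<open>K\<close> in the character space is an open null set, hence disjoint from the support.
\<close>

lemma representing_measure_support_exists:
  assumes bounded: "\<forall>a. quotient_sup L a < \<infinity> \<and> quotient_inf L a > -\<infinity>"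
  obtains M where "representing_measure L M"
    "compactin character_space (measure_support character_space M)"
    "measure_support character_space M \<subseteq> quotient_bounded_characters L"
proof -
  let ?K = "quotient_bounded_characters L"
  obtain M where M: "representing_measure L M" "emeasure M (characters - ?K) = 0"
    by (rule representing_measure_exists[OF lin psd unit bounded])
  have K: "compact ?K" by (rule compact_quotient_bounded_characters[OF lin psd unit bounded])
  have "openin character_space (characters - ?K)"
  proof -
    have "openin character_space (characters \<inter> - ?K)"
      using K by (intro openin_open_Int open_Compl compact_imp_closed)
    then show ?thesis by (simp add: Diff_eq)
  qed
  then have sub: "measure_support character_space M \<subseteq> ?K"
    using M(2) by (force simp: measure_support_def)
  have "compactin character_space ?K"
    using K quotient_bounded_characters_subset by (simp add: compactin_subtopology)
  then have "compactin character_space (measure_support character_space M)"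
    using sub closedin_measure_support by (rule closed_compactin)
  with M(1) sub show thesis by (intro that[of M])
qed

end

section \<open>The characterization\<close>

theorem theorem3p3:
  fixes L :: "'a::{comm_ring_1, real_algebra_1} \<Rightarrow> real"
  assumes "(characters :: ('a \<Rightarrow> real) set) \<noteq> {}"
    and "linear L"
    and "psd_functional L"
    and "L 1 = 1"
  shows "((\<exists>!\<mu>. representing_measure L \<mu> \<and> compactin character_space (measure_support character_space \<mu>))
            \<longleftrightarrow> (\<forall>a. quotient_sup L a < \<infinity> \<and> quotient_inf L a > -\<infinity>)) \<and>
         ((\<forall>a. quotient_sup L a < \<infinity> \<and> quotient_inf L a > -\<infinity>) \<longrightarrow>
            (\<forall>\<mu>. representing_measure L \<mu> \<and> compactin character_space (measure_support character_space \<mu>)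
                  \<longrightarrow> measure_support character_space \<mu> \<subseteq> quotient_bounded_characters L) \<and>
            (\<forall>a. (SUP \<alpha>\<in>quotient_bounded_characters L. ereal (\<alpha> a)) = quotient_sup L a \<and>
                 (INF \<alpha>\<in>quotient_bounded_characters L. ereal (\<alpha> a)) = quotient_inf L a))"
proof -
  note L = assms(2-4)
  let ?P = "\<lambda>\<mu>. representing_measure L \<mu> \<and> compactin character_space (measure_support character_space \<mu>)"
  let ?bounded = "\<forall>a. quotient_sup L a < \<infinity> \<and> quotient_inf L a > -\<infinity>"
  have unique: "\<mu> = \<nu>" if "?P \<mu>" "?P \<nu>" for \<mu> \<nu>
    using representing_measure_unique[OF L] that by blast
  have necessary: ?bounded if "?P \<mu>" for \<mu>
    using bounded_of_compact_support[OF L] that by blast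
  have exists: "\<exists>\<mu>. ?P \<mu> \<and> measure_support character_space \<mu> \<subseteq> quotient_bounded_characters L" if ?bounded
    by (rule representing_measure_support_exists[OF L that]) blast
  have "(\<exists>!\<mu>. ?P \<mu>) \<longleftrightarrow> ?bounded"
    using unique necessary exists by blast
  moreover have "measure_support character_space \<mu> \<subseteq> quotient_bounded_characters L" if ?bounded "?P \<mu>" for \<mu>
    using exists[OF that(1)] unique[OF that(2)] by blast
  ultimately show ?thesis
    using SUP_quotient_bounded_characters[OF L] INF_quotient_bounded_characters[OF L] by blast
qed

end
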